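(* Let $r\in\mathbb{R}$, $s\ge r$, $\alpha>0$, and let $f\in\mathcal{T}'$ be such that the data $g=\mathcal{I}f$ belong to $H^r(\mathbb{T}^2\times Q)$. Let $f^{\alpha,s}$ denote the Tikhonov regularized solution with data $g=\mathcal{I}f$, that is, the unique minimizer $$f^{\alpha,s}=\arg\min_{h\in H^r(\mathbb{T}^2)}\Big(\|\mathcal{I}h-g\|^2_{H^r(\mathbb{T}^2\times Q)}+\alpha\|h\|^2_{H^s(\mathbb{T}^2)}\Big).$$ For each integer $N\ge1$ let $$f_N=\sum_{v\in Q_N}\Big(\mathcal{I}_v f-\frac{|Q_N|-1}{|Q_N|}\,\hat f(0)\Big)\in\mathcal{T}',$$ where the number $\hat f(0)$ is regarded as a constant function on $\mathbb{T}^2$, and let $p_\alpha^{s-r}\in\mathcal{T}'$ be given by $$p_\alpha^{s-r}(x)=\sum_{k\in\mathbb{Z}^2}\frac{1}{1+\alpha\langle k\rangle^{2(s-r)}}\,e^{2\pi i k\cdot x}.$$ Then, in the sense of distributions, $$f^{\alpha,s}=\lim_{N\to\infty}\big(f_N*p_\alpha^{s-r}\big)\quad\text{in }\mathcal{T}'.$$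
   Context: $\mathbb{T}^2=\mathbb{R}^2/\mathbb{Z}^2$ is the flat torus, with quotient map $[\cdot]:\mathbb{R}^2\to\mathbb{T}^2$. $\mathcal{T}=C^\infty(\mathbb{T}^2)$ is the space of test functions (complex-valued, with its usual Fréchet topology) and $\mathcal{T}'$ is its dual, the space of distributions on $\mathbb{T}^2$. Convergence $u_N\to u$ in $\mathcal{T}'$ (in the sense of distributions) means $u_N(\varphi)\to u(\varphi)$ for every $\varphi\in\mathcal{T}$. Integrable functions, in particular constants, are identified with distributions by integration over $\mathbb{T}^2$. Fourier coefficients: $\hat f(k)=f(e^{-2\pi i k\cdot x})$ for $f\in\mathcal{T}'$, $k\in\mathbb{Z}^2$; the series defining $p_\alpha^{s-r}$ converges in the sense of distributions. The convolution $u*w$ of $u,w\in\mathcal{T}'$ is the usual convolution of distributions on $\mathbb{T}^2$, characterized by $\widehat{u*w}(k)=\hat u(k)\hat w(k)$ for all $k\in\mathbb{Z}^2$. Directions: $Q\subset\mathbb{Z}^2\setminus\{0\}$ is a fixed set of primitive integer vectors (coordinates with greatest common divisor $1$; the axial directions are $(1,0)$ and $(0,1)$) such that every non-zero $v\in\mathbb{Z}^2$ is an integer multiple of a unique element of $Q$; thus $Q$ contains exactly one vector from each pair $\pm v$ of primitive vectors. For an integer $N\ge1$, $\mathbb{Z}_N^2=[-N,N]^2\cap\mathbb{Z}^2$, and $Q_N$ is the finite set of those $v\in Q$ for which there is $k\in\mathbb{Z}_N^2\setminus\{0\}$ with $v\cdot k=0$. $|Q_N|$ denotes its cardinality. X-ray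 transform: for $v\in\mathbb{Z}^2\setminus\{0\}$ and $\varphi\in\mathcal{T}$, $\mathcal{I}_v\varphi(x)=\mathcal{I}\varphi(x,v)=\int_0^1\varphi([x+tv])\,dt$. The operator $\mathcal{I}_v$ is formally self-adjoint on $\mathcal{T}$ and is extended to $f\in\mathcal{T}'$ by duality: $(\mathcal{I}_vf)(\varphi)=f(\mathcal{I}_v\varphi)$. For $f\in\mathcal{T}'$, $\mathcal{I}f$ is the family $(\mathcal{I}_vf)_{v\in Q}$, regarded as an object on $\mathbb{T}^2\times Q$. Sobolev spaces: $\langle k\rangle=(1+|k|^2)^{1/2}$. For $t\in\mathbb{R}$, $H^t(\mathbb{T}^2)$ is the space of $f\in\mathcal{T}'$ with $\|f\|^2_{H^t(\mathbb{T}^2)}=\sum_{k\in\mathbb{Z}^2}\langle k\rangle^{2t}|\hat f(k)|^2<\infty$; the norm is set to $+\infty$ for $f\in\mathcal{T}'\setminus H^t(\mathbb{T}^2)$. For a family $g=(g(\cdot,v))_{v\in Q}$ of distributions on $\mathbb{T}^2$, $\hat g(k,v)$ is the $k$-th Fourier coefficient of $g(\cdot,v)$. The data space $H^t(\mathbb{T}^2\times Q)$ consists of such families for which $\hat g(0,v)$ does not depend on $v\in Q$ (its common value is denoted $\hat g(0,0)$) and $$\|g\|^2_{H^t(\mathbb{T}^2\times Q)}=|\hat g(0,0)|^2+\sum_{k\in\mathbb{Z}^2\setminus\{0\}}\sum_{v\in Q}\langle k\rangle^{2t}|\hat g(k,v)|^2<\infty .$$ *)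

theory Defs
  imports "HOL-Analysis.Analysis"
begin

section \<open>Test functions and distributions on the torus\<close>

text \<open>Points of \<open>\<real>\<^sup>2\<close> and \<open>\<int>\<^sup>2\<close> are pairs.  Functions on the torus \<open>\<real>\<^sup>2/\<int>\<^sup>2\<close> are represented by
  their lifts, i.e. by \<open>\<int>\<^sup>2\<close>-periodic functions on \<open>\<real>\<^sup>2\<close>.\<close>

type_synonym point = "real \<times> real"
type_synonym freq = "int \<times> int"
type_synonym functional = "(point \<Rightarrow> complex) \<Rightarrow> complex"

definition ivec :: "freq \<Rightarrow> point" where
  "ivec k = (of_int (fst k), of_int (snd k))"

definition periodic :: "(point \<Rightarrow> complex) \<Rightarrow> bool" where
  "periodic \<phi> \<longleftrightarrow> (\<forall>x k. \<phi> (x + ivec k) = \<phi> x)"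

text \<open>Iterated directional derivatives; only meaningful if all the intermediate derivatives
  exist, which is what \<open>smooth\<close> demands for the coordinate directions.\<close>

primrec iter_deriv :: "point list \<Rightarrow> (point \<Rightarrow> complex) \<Rightarrow> point \<Rightarrow> complex" where
  "iter_deriv [] \<phi> = \<phi>"
| "iter_deriv (b # bs) \<phi> = (\<lambda>x. frechet_derivative (iter_deriv bs \<phi>) (at x) b)"

definition smooth :: "(point \<Rightarrow> complex) \<Rightarrow> bool" where
  "smooth \<phi> \<longleftrightarrow> (\<forall>bs \<in> lists Basis. \<forall>x. iter_deriv bs \<phi> differentiable (at x))"

definition test_functions :: "(point \<Rightarrow> complex) set" where
  "test_functions = {\<phi>. smooth \<phi> \<and> periodic \<phi>}"

text \<open>The Frechet topology of \<open>C\<^sup>\<infinity>\<close>, given by the sup-seminorms of all partial derivatives.\<close>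

definition sup_norm :: "(point \<Rightarrow> complex) \<Rightarrow> real" where
  "sup_norm \<phi> = (SUP x. norm (\<phi> x))"

definition test_ball :: "nat \<Rightarrow> real \<Rightarrow> (point \<Rightarrow> complex) \<Rightarrow> (point \<Rightarrow> complex) set" where
  "test_ball m \<epsilon> \<phi> = {\<psi> \<in> test_functions.
     \<forall>bs \<in> lists Basis. length bs \<le> m \<longrightarrow> sup_norm (iter_deriv bs (\<lambda>x. \<psi> x - \<phi> x)) < \<epsilon>}"

definition test_topology :: "(point \<Rightarrow> complex) topology" where
  "test_topology = topology (\<lambda>U. U \<subseteq> test_functions \<and>
     (\<forall>\<phi> \<in> U. \<exists>m. \<exists>\<epsilon>>0. test_ball m \<epsilon> \<phi> \<subseteq> U))"

lemma test_ball_mono: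
  assumes "m \<le> n" "\<delta> \<le> \<epsilon>"
  shows "test_ball n \<delta> \<phi> \<subseteq> test_ball m \<epsilon> \<phi>"
  using assms unfolding test_ball_def by (blast intro: le_trans less_le_trans)

lemma openin_test_topology:
  "openin test_topology U \<longleftrightarrow> U \<subseteq> test_functions \<and>
     (\<forall>\<phi> \<in> U. \<exists>m. \<exists>\<epsilon>>0. test_ball m \<epsilon> \<phi> \<subseteq> U)"
proof -
  have "istopology (\<lambda>U. U \<subseteq> test_functions \<and> (\<forall>\<phi> \<in> U. \<exists>m. \<exists>\<epsilon>>0. test_ball m \<epsilon> \<phi> \<subseteq> U))"
    unfolding istopology_def
  proof (intro conjI allI impI ballI)
    fix S T \<phi>
    assume S: "S \<subseteq> test_functions \<and> (\<forall>\<phi> \<in> S. \<exists>m. \<exists>\<epsilon>>0. test_ball m \<epsilon> \<phi> \<subseteq> S)"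
      and T: "T \<subseteq> test_functions \<and> (\<forall>\<phi> \<in> T. \<exists>m. \<exists>\<epsilon>>0. test_ball m \<epsilon> \<phi> \<subseteq> T)"
    then show "S \<inter> T \<subseteq> test_functions" by blast
    assume "\<phi> \<in> S \<inter> T"
    with S T obtain m \<epsilon> n \<delta> where *: "\<epsilon> > 0" "test_ball m \<epsilon> \<phi> \<subseteq> S" "\<delta> > 0" "test_ball n \<delta> \<phi> \<subseteq> T"
      by (metis IntE)
    have "test_ball (max m n) (min \<epsilon> \<delta>) \<phi> \<subseteq> S \<inter> T"
      using *(2,4) test_ball_mono[of m "max m n" "min \<epsilon> \<delta>" \<epsilon> \<phi>]
        test_ball_mono[of n "max m n" "min \<epsilon> \<delta>" \<delta> \<phi>] by auto
    then show "\<exists>m. \<exists>\<epsilon>>0. test_ball m \<epsilon> \<phi> \<subseteq> S \<inter> T"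
      using * by (metis min_less_iff_conj)
  next
    fix \<K>
    assume K: "\<forall>K\<in>\<K>. K \<subseteq> test_functions \<and> (\<forall>\<phi> \<in> K. \<exists>m. \<exists>\<epsilon>>0. test_ball m \<epsilon> \<phi> \<subseteq> K)"
    then show "\<Union>\<K> \<subseteq> test_functions" by blast
    fix \<phi> assume "\<phi> \<in> \<Union>\<K>"
    with K show "\<exists>m. \<exists>\<epsilon>>0. test_ball m \<epsilon> \<phi> \<subseteq> \<Union>\<K>"
      by (meson UnionE Union_upper order_trans)
  qed
  then show ?thesis
    unfolding test_topology_def by (simp add: topology_inverse')
qed

lemma topspace_test_topology: "topspace test_topology = test_functions"
proof
  show "topspace test_topology \<subseteq> test_functions"
    using openin_topspace[of test_topology] openin_test_topology by blast
  have "openin test_topology test_functions"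
    unfolding openin_test_topology test_ball_def by (auto intro: exI[of _ "1::real"])
  then show "test_functions \<subseteq> topspace test_topology"
    by (rule openin_subset)
qed

text \<open>Distributions are required to be extensional (\<open>undefined\<close> off the test functions), so that
  two of them are equal in HOL iff they agree on all test functions.\<close>

definition distributions :: "functional set" where
  "distributions = {u \<in> extensional test_functions.
     (\<forall>\<phi> \<in> test_functions. \<forall>\<psi> \<in> test_functions. u (\<lambda>x. \<phi> x + \<psi> x) = u \<phi> + u \<psi>) \<and>
     (\<forall>c. \<forall>\<phi> \<in> test_functions. u (\<lambda>x. c * \<phi> x) = c * u \<phi>) \<and>
     continuous_map test_topology euclidean u}"

definition dist_lim :: "(nat \<Rightarrow> functional) \<Rightarrow> functional \<Rightarrow> bool" where
  "dist_lim u w \<longleftrightarrow> (\<forall>\<phi> \<in> test_functions. (\<lambda>N. u N \<phi>) \<longlonglongrightarrow> w \<phi>)"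

definition dist_diff :: "functional \<Rightarrow> functional \<Rightarrow> functional" where
  "dist_diff u w = (\<lambda>\<phi>\<in>test_functions. u \<phi> - w \<phi>)"

text \<open>The distribution given by an integrable function; the unit square is a fundamental domain.\<close>

definition dist_of_fun :: "(point \<Rightarrow> complex) \<Rightarrow> functional" where
  "dist_of_fun g = (\<lambda>\<phi>\<in>test_functions. integral (cbox (0, 0) (1, 1)) (\<lambda>x. g x * \<phi> x))"

definition character :: "freq \<Rightarrow> point \<Rightarrow> complex" where
  "character k x = exp (2 * of_real pi * \<i> * of_real (ivec k \<bullet> x))"

definition fourier :: "functional \<Rightarrow> freq \<Rightarrow> complex" where
  "fourier u k = u (character (- k))"

text \<open>\<open>(u * w)(\<phi>) = u\<^sub>x(w\<^sub>y(\<phi>(x + y)))\<close>\<close>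

definition dist_conv :: "functional \<Rightarrow> functional \<Rightarrow> functional" where
  "dist_conv u w = (\<lambda>\<phi>\<in>test_functions. u (\<lambda>x. w (\<lambda>y. \<phi> (x + y))))"

lemma character_has_derivative:
  "((\<lambda>x. c * character k x) has_derivative
    (\<lambda>h. c * (2 * of_real pi * \<i> * of_real (ivec k \<bullet> h)) * character k x)) (at x)"
proof -
  have "((\<lambda>x. 2 * of_real pi * \<i> * complex_of_real (ivec k \<bullet> x)) has_derivative
      (\<lambda>h. 2 * of_real pi * \<i> * of_real (ivec k \<bullet> h))) (at x)"
    by (auto intro!: derivative_eq_intros has_derivative_of_real)
  then have "(character k has_derivative
      (\<lambda>h. 2 * of_real pi * \<i> * of_real (ivec k \<bullet> h) * character k x)) (at x)"
    unfolding character_def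
    using DERIV_exp has_derivative_compose[of _ _ x UNIV exp]
    by (fastforce simp: has_field_derivative_def mult.commute)
  from has_derivative_mult_right[OF this, of c] show ?thesis
    by (simp add: mult.assoc)
qed

lemma iter_deriv_character:
  "\<exists>c. iter_deriv bs (character k) = (\<lambda>x. c * character k x)"
proof (induction bs)
  case Nil
  show ?case by (intro exI[of _ 1]) simp
next
  case (Cons b bs)
  then obtain c where c: "iter_deriv bs (character k) = (\<lambda>x. c * character k x)" by blast
  have "frechet_derivative (\<lambda>x. c * character k x) (at x) b =
      (c * (2 * of_real pi * \<i> * of_real (ivec k \<bullet> b))) * character k x" for x
  proof -
    from frechet_derivative_at[OF character_has_derivative, symmetric] show ?thesis by simp
  qed
  then show ?case unfolding iter_deriv.simps c by blast
qed

lemma character_add: "character k (x + y) = character k x * character k y"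
  by (simp add: character_def inner_add_right distrib_left exp_add)

lemma character_in_test: "character k \<in> test_functions"
proof -
  have "smooth (character k)"
    unfolding smooth_def
  proof (intro ballI allI)
    fix bs x
    obtain c where c: "iter_deriv bs (character k) = (\<lambda>x. c * character k x)"
      using iter_deriv_character by blast
    from character_has_derivative show "iter_deriv bs (character k) differentiable (at x)"
      unfolding c differentiable_def by blast
  qed
  moreover have "periodic (character k)"
    unfolding periodic_def
  proof (intro allI)
    fix x l
    have "character k (ivec l) = exp (\<i> * (of_int (fst k * fst l + snd k * snd l) * (of_real pi * 2)))"
      by (simp add: character_def ivec_def algebra_simps)
    also have "\<dots> = 1"
      by (rule exp_2pi_1_int)
    finally show "character k (x + ivec l) = character k x"
      by (simp add: character_add)
  qed
  ultimately show ?thesis by (simp add: test_functions_def)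
qed

lemma fourier_dist_conv:
  assumes "u \<in> distributions" "w \<in> distributions"
  shows "fourier (dist_conv u w) k = fourier u k * fourier w k"
proof -
  let ?e = "character (- k)"
  have scale: "z (\<lambda>x. c * ?e x) = c * z ?e" if "z \<in> distributions" for z c
    using that character_in_test[of "- k"] by (simp add: distributions_def)
  have "dist_conv u w ?e = u (\<lambda>x. w (\<lambda>y. ?e x * ?e y))"
    by (simp add: dist_conv_def character_in_test character_add)
  also have "\<dots> = u (\<lambda>x. w ?e * ?e x)"
    by (simp only: scale[OF assms(2)] mult.commute)
  also have "\<dots> = u ?e * w ?e"
    by (subst scale[OF assms(1)]) (rule mult.commute)
  finally show ?thesis by (simp only: fourier_def)
qed

section \<open>The X-ray transform\<close>

definition xray_fun :: "freq \<Rightarrow> (point \<Rightarrow> complex) \<Rightarrow> point \<Rightarrow> complex" where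
  "xray_fun v \<phi> x = integral {0..1} (\<lambda>t. \<phi> (x + t *\<^sub>R ivec v))"

definition xray :: "functional \<Rightarrow> freq \<Rightarrow> functional" where
  "xray f v = (\<lambda>\<phi>\<in>test_functions. f (xray_fun v \<phi>))"

definition direction_set :: "freq set \<Rightarrow> bool" where
  "direction_set Q \<longleftrightarrow> (\<forall>q \<in> Q. gcd (fst q) (snd q) = 1) \<and>
     (\<forall>v. v \<noteq> 0 \<longrightarrow> (\<exists>!q. q \<in> Q \<and> (\<exists>m::int. v = (m * fst q, m * snd q))))"

definition box_freqs :: "nat \<Rightarrow> freq set" where
  "box_freqs N = {- int N..int N} \<times> {- int N..int N}"

definition directions_upto :: "freq set \<Rightarrow> nat \<Rightarrow> freq set" where
  "directions_upto Q N =
     {v \<in> Q. \<exists>k \<in> box_freqs N - {0}. fst v * fst k + snd v * snd k = 0}"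

section \<open>Sobolev spaces\<close>

definition japanese :: "freq \<Rightarrow> real" where
  "japanese k = sqrt (1 + (norm (ivec k))\<^sup>2)"

text \<open>Squared norms take values in \<open>[0,\<infinity>]\<close>, where every series of non-negative terms converges.\<close>

definition sobolev_norm2 :: "real \<Rightarrow> functional \<Rightarrow> ennreal" where
  "sobolev_norm2 t f =
     (\<Sum>\<^sub>\<infinity>k\<in>UNIV. ennreal (japanese k powr (2 * t) * (norm (fourier f k))\<^sup>2))"

definition sobolev :: "real \<Rightarrow> functional set" where
  "sobolev t = {f \<in> distributions. sobolev_norm2 t f < \<infinity>}"

definition const_mean :: "freq set \<Rightarrow> (freq \<Rightarrow> functional) \<Rightarrow> bool" where
  "const_mean Q g \<longleftrightarrow> (\<exists>c. \<forall>v \<in> Q. fourier (g v) 0 = c)"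

definition mean :: "freq set \<Rightarrow> (freq \<Rightarrow> functional) \<Rightarrow> complex" where
  "mean Q g = (THE c. \<forall>v \<in> Q. fourier (g v) 0 = c)"

text \<open>The norm is only used for families with \<open>const_mean\<close>.\<close>

definition data_norm2 :: "freq set \<Rightarrow> real \<Rightarrow> (freq \<Rightarrow> functional) \<Rightarrow> ennreal" where
  "data_norm2 Q t g = ennreal ((norm (mean Q g))\<^sup>2) +
     (\<Sum>\<^sub>\<infinity>k\<in>UNIV - {0}. \<Sum>\<^sub>\<infinity>v\<in>Q.
        ennreal (japanese k powr (2 * t) * (norm (fourier (g v) k))\<^sup>2))"

text \<open>Only the values of a family on \<open>Q\<close> matter.\<close>

definition data_space :: "freq set \<Rightarrow> real \<Rightarrow> (freq \<Rightarrow> functional) set" where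
  "data_space Q t = {g. (\<forall>v \<in> Q. g v \<in> distributions) \<and> const_mean Q g \<and> data_norm2 Q t g < \<infinity>}"

section \<open>Tikhonov regularization and filtered reconstruction\<close>

definition tikhonov_functional ::
  "freq set \<Rightarrow> real \<Rightarrow> real \<Rightarrow> real \<Rightarrow> (freq \<Rightarrow> functional) \<Rightarrow> functional \<Rightarrow> ennreal" where
  "tikhonov_functional Q r s \<alpha> g h =
     data_norm2 Q r (\<lambda>v. dist_diff (xray h v) (g v)) + ennreal \<alpha> * sobolev_norm2 s h"

definition tikhonov_minimizer ::
  "freq set \<Rightarrow> real \<Rightarrow> real \<Rightarrow> real \<Rightarrow> (freq \<Rightarrow> functional) \<Rightarrow> functional \<Rightarrow> bool" where
  "tikhonov_minimizer Q r s \<alpha> g h \<longleftrightarrow>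
     is_arg_min (tikhonov_functional Q r s \<alpha> g) (\<lambda>h. h \<in> sobolev r) h"

definition tikhonov_solution ::
  "freq set \<Rightarrow> real \<Rightarrow> real \<Rightarrow> real \<Rightarrow> (freq \<Rightarrow> functional) \<Rightarrow> functional" where
  "tikhonov_solution Q r s \<alpha> g = (THE h. tikhonov_minimizer Q r s \<alpha> g h)"

definition partial_reconstruction :: "freq set \<Rightarrow> functional \<Rightarrow> nat \<Rightarrow> functional" where
  "partial_reconstruction Q f N = (\<lambda>\<phi>\<in>test_functions. \<Sum>v \<in> directions_upto Q N.
     xray f v \<phi> -
     dist_of_fun (\<lambda>_. of_real ((real (card (directions_upto Q N)) - 1) /
       real (card (directions_upto Q N))) * fourier f 0) \<phi>)"

text \<open>Here \<open>\<sigma>\<close> plays the role of \<open>s - r\<close>; the series is a sum of the distributions given by the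
  characters and is taken in the sense of distributions, i.e. after pairing with \<open>\<phi>\<close>.\<close>

definition tikhonov_filter :: "real \<Rightarrow> real \<Rightarrow> functional" where
  "tikhonov_filter \<alpha> \<sigma> = (\<lambda>\<phi>\<in>test_functions. \<Sum>\<^sub>\<infinity>k\<in>UNIV.
     of_real (1 / (1 + \<alpha> * japanese k powr (2 * \<sigma>))) * dist_of_fun (character k) \<phi>)"

end

theory Submission
  imports Defs
begin

text \<open>
  Everything becomes transparent on the Fourier side.  The operator \<open>\<I>\<^sub>v\<close> keeps the frequency \<open>k\<close>
  if \<open>v \<cdot> k = 0\<close> and kills it otherwise (\<open>fourier_xray\<close>), and a non-zero frequency is orthogonal to
  exactly one direction in \<open>Q\<close> (\<open>direction_set_perp\<close>).  Therefore the norm of the data \<open>\<I>h - \<I>f\<close> in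
  \<open>H\<^sup>r\<close> is just the norm of \<open>h - f\<close> in \<open>H\<^sup>r\<close>, and the Tikhonov functional is a sum over the frequencies
  of \<open>\<langle>k\<rangle>\<^bsup>2r\<^esup> |h(k) - f(k)|\<^sup>2 + \<alpha> \<langle>k\<rangle>\<^bsup>2s\<^esup> |h(k)|\<^sup>2\<close>, where \<open>h(k)\<close> and \<open>f(k)\<close> denote Fourier coefficients.
  Completing the square in each summand (\<open>tikhonov_functional_eq\<close>) gives a finite quantity independent
  of \<open>h\<close> plus a weighted sum of the squares \<open>|h(k) - d(k) f(k)|\<^sup>2\<close> with
  \<open>d(k) = 1 / (1 + \<alpha> \<langle>k\<rangle>\<^bsup>2(s - r)\<^esup>)\<close>.  So the minimizer is the distribution with the coefficients
  \<open>d(k) f(k)\<close>, and no other (\<open>tikhonov_minimizer_iff\<close>).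

  The \<open>d(k)\<close> are also the coefficients of the filter.  The partial reconstruction \<open>f\<^sub>N\<close> has the
  coefficient \<open>f(k)\<close> at those frequencies which are orthogonal to a direction in \<open>Q\<^sub>N\<close>, and \<open>0\<close> at the
  other ones; the constant subtracted in its definition corrects the frequency \<open>0\<close>, which
  all \<open>|Q\<^sub>N|\<close> directions see (\<open>partial_reconstruction_fseries\<close>).  Paired with a test function, the
  filtered reconstruction is thus a partial sum of the absolutely convergent series for the minimizer,
  extended over a set of frequencies that contains \<open>[-N, N]\<^sup>2\<close>.

  Passing between distributions and coefficients rests on three facts.  The test functions are
  exactly the Fourier series with rapidly decreasing coefficients (\<open>fseries_in_test\<close>,
  \<open>rapid_fcoeff\<close>, \<open>test_function_eq_fseries\<close>); a distribution may be applied to such a series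
  term by term (\<open>distribution_fseries\<close>), so that it is determined by its coefficients; and all
  coefficients of at most polynomial growth belong to a distribution
  (\<open>dist_of_coeffs_in_distributions\<close>).
\<close>

text \<open>Points and frequencies are pairs, but quantifiers over them are best kept intact.\<close>

declare split_paired_All [simp del] split_paired_Ex [simp del]

section \<open>Rapidly decreasing Fourier coefficients\<close>

lemma japanese_power2: "(japanese k)\<^sup>2 = 1 + (of_int (fst k))\<^sup>2 + (of_int (snd k))\<^sup>2"
  by (simp add: japanese_def ivec_def norm_prod_def add_nonneg_nonneg)

lemma japanese_ge_1: "1 \<le> japanese k"
  by (simp add: japanese_def)

lemma japanese_pos: "0 < japanese k"
  using japanese_ge_1[of k] by linarith

lemma japanese_0 [simp]: "japanese 0 = 1"
  by (simp add: japanese_def ivec_def zero_prod_def)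

lemma japanese_minus [simp]: "japanese (- k) = japanese k"
  by (simp add: japanese_def ivec_def norm_prod_def)

lemma norm_ivec_le_japanese: "norm (ivec k) \<le> japanese k"
  unfolding japanese_def by (rule real_le_rsqrt) simp

lemma character_eq_cis: "character k x = cis (2 * pi * (ivec k \<bullet> x))"
  by (simp add: character_def cis_conv_exp mult_ac)

lemma norm_character [simp]: "norm (character k x) = 1"
  by (simp add: character_eq_cis)

lemma character_0_freq [simp]: "character 0 x = 1"
  by (simp add: character_eq_cis ivec_def inner_prod_def)

lemma character_add_freq: "character (k + l) x = character k x * character l x"
  by (simp add: character_eq_cis cis_mult ivec_def inner_prod_def algebra_simps)

text \<open>The exponent \<open>4\<close> makes the weight dominate a product of two one-dimensional weights, because
  \<open>(1 + m\<^sup>2) (1 + n\<^sup>2) \<le> (1 + m\<^sup>2 + n\<^sup>2)\<^sup>2\<close>.\<close>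

lemma summable_on_inverse_japanese: "(\<lambda>k. 1 / japanese k ^ 4) summable_on UNIV"
proof -
  let ?g = "\<lambda>n::int. 1 / (1 + (of_int n :: real)\<^sup>2)"
  have nat: "(\<lambda>n::nat. 1 / (1 + (of_nat n :: real)\<^sup>2)) summable_on UNIV"
  proof (rule summable_nonneg_imp_summable_on)
    have "summable (\<lambda>n. 1 / (of_nat (Suc n) :: real)\<^sup>2)"
      using inverse_power_summable[of 2, where 'a = real]
      by (subst summable_Suc_iff) (simp add: field_simps)
    then have "summable (\<lambda>n. 1 / (of_nat n :: real)\<^sup>2)"
      by (subst (asm) summable_Suc_iff) simp
    then show "summable (\<lambda>n::nat. 1 / (1 + (of_nat n :: real)\<^sup>2))"
    proof (rule summable_comparison_test'[where N = 1])
      fix n :: nat assume "1 \<le> n"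
      then have "0 < (real n)\<^sup>2" by simp
      then show "norm (1 / (1 + (real n)\<^sup>2)) \<le> 1 / (real n)\<^sup>2"
        by (simp add: frac_le)
    qed
  qed simp
  have pos: "?g summable_on range int"
    by (subst summable_on_reindex) (use nat in \<open>auto simp: o_def\<close>)
  have neg: "?g summable_on range (\<lambda>n. - int n)"
    by (subst summable_on_reindex) (use nat in \<open>auto simp: o_def inj_on_def\<close>)
  have "n \<in> range int \<union> range (\<lambda>n. - int n)" for n
    by (cases n rule: int_cases2) auto
  then have "range int \<union> range (\<lambda>n. - int n) = UNIV" by blast
  then have g: "?g summable_on UNIV"
    using summable_on_union[OF pos neg] by simp
  have "(\<lambda>k. ?g (fst k) * ?g (snd k)) summable_on UNIV \<times> UNIV"
  proof (rule summable_on_SigmaI)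
    show "((\<lambda>m. ?g (fst (n, m)) * ?g (snd (n, m))) has_sum ?g n * infsum ?g UNIV) UNIV" for n
      using has_sum_cmult_right[OF has_sum_infsum[OF g], of "?g n"] by simp
    show "(\<lambda>n. ?g n * infsum ?g UNIV) summable_on UNIV"
      by (rule summable_on_cmult_left[OF g])
  qed simp
  then have "(\<lambda>k. ?g (fst k) * ?g (snd k)) summable_on UNIV" by simp
  then show ?thesis
  proof (rule summable_on_comparison_test)
    fix k :: freq
    define a b where "a = (of_int (fst k) :: real)\<^sup>2" and "b = (of_int (snd k) :: real)\<^sup>2"
    have ab: "a \<ge> 0" "b \<ge> 0" by (simp_all add: a_def b_def)
    have "japanese k ^ 4 = (1 + a + b)\<^sup>2"
      using japanese_power2[of k] unfolding a_def b_def
      by (metis mult_2 numeral_Bit0 power2_eq_square power_add)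
    moreover have "(1 + a) * (1 + b) \<le> (1 + a + b)\<^sup>2"
      using ab by (simp add: power2_eq_square algebra_simps)
    moreover have "0 < (1 + a) * (1 + b)"
      using ab by (simp add: add_pos_nonneg)
    ultimately have "1 / japanese k ^ 4 \<le> 1 / ((1 + a) * (1 + b))"
      by (metis divide_left_mono less_le_trans mult_pos_pos zero_le_one)
    then show "1 / japanese k ^ 4 \<le> ?g (fst k) * ?g (snd k)"
      by (simp add: a_def b_def)
  qed (simp add: japanese_pos less_imp_le)
qed

definition rapid :: "(freq \<Rightarrow> complex) \<Rightarrow> bool" where
  "rapid a \<longleftrightarrow> (\<forall>M. \<exists>C. \<forall>k. norm (a k) * japanese k ^ M \<le> C)"

definition moderate :: "(freq \<Rightarrow> complex) \<Rightarrow> bool" where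
  "moderate c \<longleftrightarrow> (\<exists>M C. \<forall>k. norm (c k) \<le> C * japanese k ^ M)"

lemma rapid_mult_moderate:
  assumes "moderate c" "rapid a"
  shows "rapid (\<lambda>k. c k * a k)"
  unfolding rapid_def
proof
  fix M
  from assms(1) obtain L C where C: "norm (c k) \<le> C * japanese k ^ L" for k
    unfolding moderate_def by blast
  from assms(2) obtain B where B: "norm (a k) * japanese k ^ (L + M) \<le> B" for k
    unfolding rapid_def by blast
  have C0: "C \<ge> 0"
    using order_trans[OF norm_ge_zero C[of 0]] by simp
  have "norm (c k * a k) * japanese k ^ M \<le> C * B" for k
  proof -
    have "norm (c k * a k) * japanese k ^ M \<le> (C * japanese k ^ L) * (norm (a k) * japanese k ^ M)"
      using mult_right_mono[OF C[of k], of "norm (a k) * japanese k ^ M"] japanese_pos[of k]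
      by (simp add: norm_mult mult.assoc)
    also have "\<dots> = C * (norm (a k) * japanese k ^ (L + M))"
      by (simp add: power_add)
    also have "\<dots> \<le> C * B"
      using B[of k] C0 by (simp add: mult_left_mono)
    finally show ?thesis .
  qed
  then show "\<exists>C. \<forall>k. norm (c k * a k) * japanese k ^ M \<le> C" by blast
qed

lemma moderate_bounded:
  assumes "\<And>k. norm (c k) \<le> C"
  shows "moderate c"
  unfolding moderate_def using assms by (intro exI[of _ 0] exI[of _ C]) simp

lemma rapid_dominated:
  assumes "rapid a" "\<And>k. norm (b k) \<le> norm (a k)"
  shows "rapid b"
  using assms unfolding rapid_def
  by (meson japanese_pos less_imp_le mult_right_mono order_trans zero_le_power)

lemma rapid_summable_weighted:
  assumes "rapid a"
  shows "(\<lambda>k. norm (a k) * japanese k ^ M) summable_on UNIV"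
proof -
  from assms obtain C where C: "norm (a k) * japanese k ^ (M + 4) \<le> C" for k
    unfolding rapid_def by blast
  have "(\<lambda>k. C * (1 / japanese k ^ 4)) summable_on UNIV"
    by (intro summable_on_cmult_right summable_on_inverse_japanese)
  then show ?thesis
  proof (rule summable_on_comparison_test)
    fix k
    show "norm (a k) * japanese k ^ M \<le> C * (1 / japanese k ^ 4)"
      using C[of k] japanese_pos[of k] by (simp add: power_add field_simps)
  qed (use japanese_pos in \<open>simp add: less_imp_le\<close>)
qed

lemma rapid_abs_summable:
  assumes "rapid a"
  shows "(\<lambda>k. norm (a k)) summable_on A"
  using rapid_summable_weighted[OF assms, of 0] by (auto intro: summable_on_subset_banach)

section \<open>Fourier series with rapidly decreasing coefficients\<close>

definition fseries :: "(freq \<Rightarrow> complex) \<Rightarrow> point \<Rightarrow> complex" where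
  "fseries a x = (\<Sum>\<^sub>\<infinity>k. a k * character k x)"

lemma fseries_summable:
  assumes "rapid a"
  shows "(\<lambda>k. a k * character k x) summable_on A"
  by (rule abs_summable_summable) (simp add: norm_mult rapid_abs_summable[OF assms])

lemma norm_fseries_le:
  assumes "rapid a"
  shows "norm (fseries a x) \<le> (\<Sum>\<^sub>\<infinity>k. norm (a k))"
  unfolding fseries_def
  using norm_infsum_bound[of "\<lambda>k. a k * character k x" UNIV]
  by (simp add: norm_mult rapid_abs_summable[OF assms])

lemma fseries_diff:
  assumes "rapid a" "rapid b"
  shows "fseries (\<lambda>k. a k - b k) x = fseries a x - fseries b x"
proof -
  have "fseries (\<lambda>k. a k - b k) x = (\<Sum>\<^sub>\<infinity>k. a k * character k x + - (b k * character k x))"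
    by (simp add: fseries_def algebra_simps)
  also have "\<dots> = fseries a x - fseries b x"
    using assms unfolding fseries_def
    by (subst infsum_add) (auto intro!: fseries_summable simp: infsum_uminus summable_on_uminus)
  finally show ?thesis .
qed

text \<open>Multiplication by this symbol is the derivative along \<open>b\<close> on the side of the coefficients.\<close>

definition dsymbol :: "point \<Rightarrow> freq \<Rightarrow> complex" where
  "dsymbol b k = 2 * of_real pi * \<i> * of_real (ivec k \<bullet> b)"

lemma norm_dsymbol_le: "norm (dsymbol b k) \<le> 2 * pi * norm b * japanese k"
proof -
  have "\<bar>ivec k \<bullet> b\<bar> \<le> japanese k * norm b"
    by (rule order_trans[OF Cauchy_Schwarz_ineq2])
      (simp add: mult_right_mono norm_ivec_le_japanese)
  then show ?thesis
    by (simp add: dsymbol_def norm_mult mult_ac)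
qed

lemma moderate_dsymbol: "moderate (dsymbol b)"
  unfolding moderate_def
  by (intro exI[of _ 1] exI[of _ "2 * pi * norm b"]) (simp add: norm_dsymbol_le)

lemma rapid_dsymbol:
  assumes "rapid a"
  shows "rapid (\<lambda>k. dsymbol b k * a k)"
  by (rule rapid_mult_moderate[OF moderate_dsymbol assms])

lemma norm_exp_imaginary_Taylor:
  fixes t :: real
  shows "norm (exp (\<i> * t) - 1 - \<i> * t) \<le> t\<^sup>2"
  using Taylor_exp[of "\<i> * t" 1] by (simp add: norm_mult power2_eq_square algebra_simps)

lemma norm_character_Taylor:
  "norm (character k y - character k x - dsymbol (y - x) k * character k x)
     \<le> (2 * pi * japanese k * norm (y - x))\<^sup>2"
proof -
  define t where "t = 2 * pi * (ivec k \<bullet> (y - x))"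
  have "character k y = exp (\<i> * t) * character k x"
    using character_add[of k "y - x" x] by (simp add: character_def t_def mult_ac)
  moreover have "dsymbol (y - x) k = \<i> * t"
    by (simp add: dsymbol_def t_def mult_ac)
  ultimately have "character k y - character k x - dsymbol (y - x) k * character k x
      = (exp (\<i> * t) - 1 - \<i> * t) * character k x"
    by (simp add: algebra_simps)
  then have "norm (character k y - character k x - dsymbol (y - x) k * character k x) \<le> t\<^sup>2"
    using norm_exp_imaginary_Taylor[of t] by (simp add: norm_mult)
  also have "t\<^sup>2 \<le> (2 * pi * japanese k * norm (y - x))\<^sup>2"
  proof -
    have "\<bar>t\<bar> \<le> 2 * pi * japanese k * norm (y - x)"
      using norm_dsymbol_le[of "y - x" k] \<open>dsymbol (y - x) k = \<i> * t\<close>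
      by (simp add: norm_mult mult_ac)
    then show ?thesis
      by (metis abs_ge_zero power2_abs power_mono)
  qed
  finally show ?thesis .
qed

text \<open>Termwise differentiation: the second order Taylor remainder of the character \<open>k\<close> is
  quadratic in the increment with a constant of order \<open>\<langle>k\<rangle>\<^sup>2\<close>, which the coefficients absorb.\<close>

lemma fseries_has_derivative:
  assumes a: "rapid a"
  shows "(fseries a has_derivative (\<lambda>h. fseries (\<lambda>k. dsymbol h k * a k) x)) (at x)"
proof -
  let ?D = "\<lambda>h. fseries (\<lambda>k. dsymbol h k * a k) x"
  let ?C = "\<Sum>\<^sub>\<infinity>k. (2 * pi)\<^sup>2 * (norm (a k) * japanese k ^ 2)"
  have sumC: "(\<lambda>k. (2 * pi)\<^sup>2 * (norm (a k) * japanese k ^ 2)) summable_on UNIV"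
    by (intro summable_on_cmult_right rapid_summable_weighted a)
  note summ = fseries_summable[OF a] fseries_summable[OF rapid_dsymbol[OF a]]
  have add: "?D (h + h') = ?D h + ?D h'" for h h'
    unfolding fseries_def infsum_add[OF summ(2) summ(2), symmetric]
    by (intro infsum_cong) (simp add: dsymbol_def inner_add_right algebra_simps)
  have scale: "?D (c *\<^sub>R h) = c *\<^sub>R ?D h" for c h
    unfolding fseries_def
    by (subst infsum_scaleR_right[symmetric])
      (auto intro!: infsum_cong simp: dsymbol_def scaleR_conv_of_real)
  have "bounded_linear ?D"
  proof (rule bounded_linear_intro)
    fix h
    have "norm (?D h) \<le> (\<Sum>\<^sub>\<infinity>k. norm (dsymbol h k * a k))"
      by (rule norm_fseries_le[OF rapid_dsymbol[OF a]])
    also have "\<dots> \<le> (\<Sum>\<^sub>\<infinity>k. (2 * pi * norm h) * (norm (a k) * japanese k ^ 1))"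
    proof (rule infsum_mono)
      show "(\<lambda>k. norm (dsymbol h k * a k)) summable_on UNIV"
        by (rule rapid_abs_summable[OF rapid_dsymbol[OF a]])
      show "(\<lambda>k. (2 * pi * norm h) * (norm (a k) * japanese k ^ 1)) summable_on UNIV"
        by (intro summable_on_cmult_right rapid_summable_weighted a)
      fix k
      show "norm (dsymbol h k * a k) \<le> 2 * pi * norm h * (norm (a k) * japanese k ^ 1)"
        using mult_right_mono[OF norm_dsymbol_le[of h k] norm_ge_zero[of "a k"]]
        by (simp add: norm_mult mult_ac)
    qed
    also have "\<dots> = norm h * (2 * pi * (\<Sum>\<^sub>\<infinity>k. norm (a k) * japanese k ^ 1))"
      by (simp add: infsum_cmult_right')
    finally show "norm (?D h) \<le> norm h * (2 * pi * (\<Sum>\<^sub>\<infinity>k. norm (a k) * japanese k ^ 1))" .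
  qed (use add scale in auto)
  moreover have "((\<lambda>y. norm (fseries a y - fseries a x - ?D (y - x)) / norm (y - x)) \<longlongrightarrow> 0) (at x)"
  proof (rule Lim_null_comparison)
    have bound: "norm (fseries a y - fseries a x - ?D (y - x)) \<le> ?C * norm (y - x) ^ 2" for y
    proof -
      let ?R = "\<lambda>k. a k * (character k y - character k x - dsymbol (y - x) k * character k x)"
      have "(?R has_sum (fseries a y - fseries a x - ?D (y - x))) UNIV"
        using has_sum_add[OF has_sum_add[OF has_sum_infsum[OF summ(1), of y]
            has_sum_uminusI[OF has_sum_infsum[OF summ(1), of x]]]
            has_sum_uminusI[OF has_sum_infsum[OF summ(2), of "y - x" x]], of UNIV]
        by (simp add: fseries_def algebra_simps)
      then have eq: "fseries a y - fseries a x - ?D (y - x) = infsum ?R UNIV"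
        by (rule infsumI[symmetric])
      have "norm (infsum ?R UNIV) \<le> ?C * norm (y - x) ^ 2"
      proof (rule norm_infsum_le)
        show "((\<lambda>k. (2 * pi)\<^sup>2 * (norm (a k) * japanese k ^ 2) * norm (y - x) ^ 2) has_sum
            ?C * norm (y - x) ^ 2) UNIV"
          by (intro has_sum_cmult_left has_sum_infsum sumC)
        show "(?R has_sum infsum ?R UNIV) UNIV"
          using \<open>(?R has_sum _) UNIV\<close> by (simp add: eq)
        fix k
        show "norm (?R k) \<le> (2 * pi)\<^sup>2 * (norm (a k) * japanese k ^ 2) * norm (y - x) ^ 2"
          using mult_left_mono[OF norm_character_Taylor[of k y x] norm_ge_zero[of "a k"]]
          by (simp add: norm_mult power_mult_distrib mult_ac)
      qed
      then show ?thesis by (simp only: eq)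
    qed
    show "\<forall>\<^sub>F y in at x. norm (norm (fseries a y - fseries a x - ?D (y - x)) / norm (y - x))
        \<le> ?C * norm (y - x)"
      unfolding eventually_at_topological
      using bound by (intro exI[of _ UNIV]) (auto simp: divide_simps power2_eq_square mult_ac)
    have "((\<lambda>y. ?C * norm (y - x)) \<longlongrightarrow> ?C * norm (x - x)) (at x)"
      by (intro tendsto_intros)
    then show "((\<lambda>y. ?C * norm (y - x)) \<longlongrightarrow> 0) (at x)" by simp
  qed
  ultimately show ?thesis
    by (simp add: has_derivative_iff_norm)
qed

definition dsymbols :: "point list \<Rightarrow> freq \<Rightarrow> complex" where
  "dsymbols bs k = prod_list (map (\<lambda>b. dsymbol b k) bs)"

lemma dsymbols_Nil [simp]: "dsymbols [] k = 1"
  and dsymbols_Cons [simp]: "dsymbols (b # bs) k = dsymbol b k * dsymbols bs k"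
  by (simp_all add: dsymbols_def)

lemma norm_dsymbols_le:
  assumes "bs \<in> lists Basis"
  shows "norm (dsymbols bs k) \<le> (2 * pi * japanese k) ^ length bs"
  using assms
proof (induction bs)
  case (Cons b bs)
  then have "norm (dsymbol b k) \<le> 2 * pi * japanese k"
    using norm_dsymbol_le[of b k] by simp
  with Cons show ?case
    using japanese_pos[of k] by (auto simp: norm_mult intro!: mult_mono)
qed simp

lemma rapid_dsymbols:
  assumes "rapid a"
  shows "rapid (\<lambda>k. dsymbols bs k * a k)"
proof (induction bs)
  case (Cons b bs)
  then show ?case using rapid_dsymbol[OF Cons, of b] by (simp add: mult.assoc)
qed (simp add: assms)

lemma iter_deriv_fseries:
  assumes "rapid a"
  shows "iter_deriv bs (fseries a) = fseries (\<lambda>k. dsymbols bs k * a k)"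
proof (induction bs)
  case (Cons b bs)
  show ?case
    using frechet_derivative_at[OF fseries_has_derivative[OF rapid_dsymbols[OF assms, of bs]], symmetric]
    by (simp add: Cons mult.assoc)
qed simp

lemma character_periodic: "character k (x + ivec l) = character k x"
  using character_in_test[of k] by (simp only: test_functions_def periodic_def mem_Collect_eq)

lemma fseries_in_test:
  assumes "rapid a"
  shows "fseries a \<in> test_functions"
proof -
  have "smooth (fseries a)"
    unfolding smooth_def
    using fseries_has_derivative[OF rapid_dsymbols[OF assms]]
    by (auto simp: iter_deriv_fseries[OF assms] differentiable_def)
  moreover have "periodic (fseries a)"
    by (simp add: periodic_def fseries_def character_periodic)
  ultimately show ?thesis by (simp add: test_functions_def)
qed

section \<open>Distributions and Fourier series\<close>

lemma distribution_add:
  "u \<in> distributions \<Longrightarrow> \<phi> \<in> test_functions \<Longrightarrow> \<psi> \<in> test_functions \<Longrightarrow>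
    u (\<lambda>x. \<phi> x + \<psi> x) = u \<phi> + u \<psi>"
  and distribution_scale:
  "u \<in> distributions \<Longrightarrow> \<phi> \<in> test_functions \<Longrightarrow> u (\<lambda>x. c * \<phi> x) = c * u \<phi>"
  by (simp_all add: distributions_def)

text \<open>Continuity for the topology of the test functions follows from a Lipschitz bound in terms of
  finitely many of the seminorms.\<close>

lemma distributionI:
  assumes "u \<in> extensional test_functions"
    and "\<And>\<phi> \<psi>. \<phi> \<in> test_functions \<Longrightarrow> \<psi> \<in> test_functions \<Longrightarrow> u (\<lambda>x. \<phi> x + \<psi> x) = u \<phi> + u \<psi>"
    and "\<And>c \<phi>. \<phi> \<in> test_functions \<Longrightarrow> u (\<lambda>x. c * \<phi> x) = c * u \<phi>"
    and bound: "\<And>\<phi> \<psi> \<delta>. \<phi> \<in> test_functions \<Longrightarrow> \<psi> \<in> test_ball M \<delta> \<phi> \<Longrightarrow> norm (u \<psi> - u \<phi>) \<le> C * \<delta>"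
  shows "u \<in> distributions"
proof -
  have "continuous_map test_topology euclidean u"
    unfolding continuous_map_def
  proof (intro conjI allI impI)
    fix U :: "complex set" assume "openin euclidean U"
    then have U: "open U" by simp
    show "openin test_topology {\<phi> \<in> topspace test_topology. u \<phi> \<in> U}"
      unfolding openin_test_topology topspace_test_topology
    proof (intro conjI ballI)
      fix \<phi> assume "\<phi> \<in> {\<phi> \<in> test_functions. u \<phi> \<in> U}"
      then have \<phi>: "\<phi> \<in> test_functions" "u \<phi> \<in> U" by auto
      from U \<phi>(2) obtain e where e: "e > 0" "ball (u \<phi>) e \<subseteq> U"
        using open_contains_ball by blast
      define \<delta> where "\<delta> = e / (\<bar>C\<bar> + 1)"
      have \<delta>: "\<delta> > 0" and C\<delta>: "C * \<delta> < e"
      proof -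
        show "\<delta> > 0" using e by (simp add: \<delta>_def add_nonneg_pos)
        have "C * \<delta> < (\<bar>C\<bar> + 1) * \<delta>" using \<open>\<delta> > 0\<close> by (intro mult_strict_right_mono) auto
        also have "\<dots> = e" unfolding \<delta>_def by (simp add: field_simps)
        finally show "C * \<delta> < e" .
      qed
      have "test_ball M \<delta> \<phi> \<subseteq> {\<phi> \<in> test_functions. u \<phi> \<in> U}"
      proof
        fix \<psi> assume \<psi>: "\<psi> \<in> test_ball M \<delta> \<phi>"
        from bound[OF \<phi>(1) \<psi>] C\<delta> have "dist (u \<phi>) (u \<psi>) < e"
          by (simp add: dist_norm norm_minus_commute)
        with e \<psi> show "\<psi> \<in> {\<phi> \<in> test_functions. u \<phi> \<in> U}"
          by (auto simp: test_ball_def)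
      qed
      with \<delta> show "\<exists>m. \<exists>\<epsilon>>0. test_ball m \<epsilon> \<phi> \<subseteq> {\<phi> \<in> test_functions. u \<phi> \<in> U}" by blast
    qed auto
  qed simp
  with assms(1-3) show ?thesis by (simp add: distributions_def)
qed

lemma has_sum_restrict_finite:
  fixes f :: "'a \<Rightarrow> 'b :: {comm_monoid_add, t2_space}"
  assumes "finite F"
  shows "((\<lambda>k. if k \<in> F then f k else 0) has_sum sum f F) UNIV"
  by (rule has_sum_finite_neutralI[OF assms]) auto

lemma fseries_finite:
  assumes "finite F"
  shows "fseries (\<lambda>k. if k \<in> F then a k else 0) x = (\<Sum>k\<in>F. a k * character k x)"
  unfolding fseries_def
  using has_sum_restrict_finite[OF assms, of "\<lambda>k. a k * character k x"]
  by (intro infsumI) (simp add: if_distrib[of "\<lambda>z. z * _"] cong: if_cong)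

lemma rapid_restrict: "rapid a \<Longrightarrow> rapid (\<lambda>k. if P k then a k else 0)"
  by (erule rapid_dominated) simp

lemma distribution_finite_fseries:
  assumes u: "u \<in> distributions" and a: "rapid a" and F: "finite F"
  shows "u (fseries (\<lambda>k. if k \<in> F then a k else 0)) = (\<Sum>k\<in>F. a k * u (character k))"
  using F
proof (induction F)
  case empty
  have "u (\<lambda>x. 0 * character 0 x) = 0 * u (character 0)"
    by (rule distribution_scale[OF u character_in_test])
  then show ?case by (simp add: fseries_def)
next
  case (insert l F)
  have one: "(\<lambda>x. a l * character l x) \<in> test_functions"
  proof -
    have "(\<lambda>x. a l * character l x) = fseries (\<lambda>k. if k \<in> {l} then a k else 0)"
      by (intro ext) (simp only: fseries_finite finite.intros, simp)
    also have "\<dots> \<in> test_functions" by (intro fseries_in_test rapid_restrict a)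
    finally show ?thesis .
  qed
  have "fseries (\<lambda>k. if k \<in> insert l F then a k else 0) =
      (\<lambda>x. a l * character l x + fseries (\<lambda>k. if k \<in> F then a k else 0) x)"
    using insert.hyps by (intro ext) (simp only: fseries_finite finite_insert, simp)
  then have "u (fseries (\<lambda>k. if k \<in> insert l F then a k else 0)) =
      u (\<lambda>x. a l * character l x) + u (fseries (\<lambda>k. if k \<in> F then a k else 0))"
    using distribution_add[OF u one fseries_in_test[OF rapid_restrict[OF a]]] by simp
  with insert show ?case
    using distribution_scale[OF u character_in_test] by simp
qed

lemma sup_norm_iter_deriv_fseries_le:
  assumes a: "rapid a" and bs: "bs \<in> lists Basis" "length bs \<le> m"
  shows "sup_norm (iter_deriv bs (fseries a)) \<le> (2 * pi) ^ m * (\<Sum>\<^sub>\<infinity>k. norm (a k) * japanese k ^ m)"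
proof -
  have "norm (fseries (\<lambda>k. dsymbols bs k * a k) x)
      \<le> (2 * pi) ^ m * (\<Sum>\<^sub>\<infinity>k. norm (a k) * japanese k ^ m)" for x
  proof -
    have "norm (fseries (\<lambda>k. dsymbols bs k * a k) x) \<le> (\<Sum>\<^sub>\<infinity>k. norm (dsymbols bs k * a k))"
      by (rule norm_fseries_le[OF rapid_dsymbols[OF a]])
    also have "\<dots> \<le> (\<Sum>\<^sub>\<infinity>k. (2 * pi) ^ m * (norm (a k) * japanese k ^ m))"
    proof (rule infsum_mono)
      show "(\<lambda>k. norm (dsymbols bs k * a k)) summable_on UNIV"
        by (rule rapid_abs_summable[OF rapid_dsymbols[OF a]])
      show "(\<lambda>k. (2 * pi) ^ m * (norm (a k) * japanese k ^ m)) summable_on UNIV"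
        by (intro summable_on_cmult_right rapid_summable_weighted a)
      fix k
      have "1 * 1 \<le> (2 * pi) * japanese k"
        using pi_ge_two japanese_ge_1[of k] by (intro mult_mono) auto
      then have "(2 * pi * japanese k) ^ length bs \<le> (2 * pi * japanese k) ^ m"
        using bs by (intro power_increasing) auto
      then have "norm (dsymbols bs k) \<le> (2 * pi * japanese k) ^ m"
        using norm_dsymbols_le[OF bs(1), of k] by linarith
      from mult_right_mono[OF this, of "norm (a k)"]
      show "norm (dsymbols bs k * a k) \<le> (2 * pi) ^ m * (norm (a k) * japanese k ^ m)"
        by (simp add: norm_mult power_mult_distrib mult_ac)
    qed
    also have "\<dots> = (2 * pi) ^ m * (\<Sum>\<^sub>\<infinity>k. norm (a k) * japanese k ^ m)"
      by (simp add: infsum_cmult_right')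
    finally show ?thesis .
  qed
  then show ?thesis
    unfolding sup_norm_def iter_deriv_fseries[OF a] by (intro cSUP_least) auto
qed

text \<open>The partial sums of \<open>fseries a\<close> converge in the topology of the test functions, since the
  remainder is the Fourier series of the remaining coefficients.  Hence a distribution may be
  applied termwise.\<close>

lemma distribution_fseries:
  assumes u: "u \<in> distributions" and a: "rapid a"
  shows "((\<lambda>k. a k * u (character k)) has_sum u (fseries a)) UNIV"
  unfolding has_sum_def
proof (rule tendstoI)
  fix e :: real assume e: "e > 0"
  let ?z = "\<lambda>_::point. 0 :: complex"
  have z_eq: "?z = fseries (\<lambda>_. 0)" by (simp add: fseries_def fun_eq_iff)
  have z: "?z \<in> test_functions"
    unfolding z_eq by (rule fseries_in_test) (auto simp: rapid_def)
  have uz: "u ?z = 0"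
    using distribution_scale[OF u z, of 0] by simp
  have "openin test_topology {\<phi> \<in> topspace test_topology. u \<phi> \<in> ball 0 e}"
    using u by (intro openin_continuous_map_preimage[of _ euclidean]) (auto simp: distributions_def)
  moreover have "?z \<in> {\<phi> \<in> topspace test_topology. u \<phi> \<in> ball 0 e}"
    using z e uz by (simp add: topspace_test_topology)
  ultimately obtain m \<epsilon> where \<epsilon>: "\<epsilon> > 0"
    and ball: "test_ball m \<epsilon> ?z \<subseteq> {\<phi> \<in> topspace test_topology. u \<phi> \<in> ball 0 e}"
    unfolding openin_test_topology by meson
  let ?w = "\<lambda>k. norm (a k) * japanese k ^ m"
  define \<epsilon>' where "\<epsilon>' = \<epsilon> / (2 * pi) ^ m"
  have "\<epsilon>' > 0" using \<epsilon> by (simp add: \<epsilon>'_def)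
  have w: "?w summable_on UNIV" by (rule rapid_summable_weighted[OF a])
  have "((\<lambda>F. sum ?w F) \<longlongrightarrow> infsum ?w UNIV) (finite_subsets_at_top UNIV)"
    using has_sum_infsum[OF w] by (simp add: has_sum_def)
  from tendstoD[OF this \<open>\<epsilon>' > 0\<close>]
  have ev: "\<forall>\<^sub>F F in finite_subsets_at_top UNIV. dist (sum ?w F) (infsum ?w UNIV) < \<epsilon>'" .
  show "\<forall>\<^sub>F F in finite_subsets_at_top UNIV. dist (\<Sum>k\<in>F. a k * u (character k)) (u (fseries a)) < e"
    using eventually_conj[OF ev eventually_finite_subsets_at_top_weakI[of UNIV finite]]
  proof (rule eventually_mono)
    fix F :: "freq set" assume "dist (sum ?w F) (infsum ?w UNIV) < \<epsilon>' \<and> finite F"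
    then have F: "dist (sum ?w F) (infsum ?w UNIV) < \<epsilon>'" "finite F" by auto
    let ?b = "\<lambda>k. if k \<in> F then a k else 0" and ?c = "\<lambda>k. if k \<in> F then 0 else a k"
    have rb: "rapid ?b" and rc: "rapid ?c" by (rule rapid_dominated[OF a]; simp)+
    have "(\<lambda>k. ?c k) = (\<lambda>k. a k - ?b k)" by auto
    then have c_eq: "fseries ?c x = fseries a x - fseries ?b x" for x
      using fseries_diff[OF a rb, of x] by simp
    have "((\<lambda>k. ?w k - (if k \<in> F then ?w k else 0)) has_sum (infsum ?w UNIV - sum ?w F)) UNIV"
      using has_sum_add[OF has_sum_infsum[OF w] has_sum_uminusI[OF has_sum_restrict_finite[OF F(2), of ?w]]]
      by simp
    then have "(\<Sum>\<^sub>\<infinity>k. norm (?c k) * japanese k ^ m) = infsum ?w UNIV - sum ?w F"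
      by (intro infsumI) (simp add: if_distrib if_distribR cong: if_cong)
    then have "(\<Sum>\<^sub>\<infinity>k. norm (?c k) * japanese k ^ m) < \<epsilon>'"
      using F(1) by (simp add: dist_real_def)
    then have small: "(2 * pi) ^ m * (\<Sum>\<^sub>\<infinity>k. norm (?c k) * japanese k ^ m) < \<epsilon>"
      unfolding \<epsilon>'_def by (simp add: pos_less_divide_eq mult.commute)
    have "fseries ?c \<in> test_ball m \<epsilon> ?z"
      unfolding test_ball_def
      using fseries_in_test[OF rc] le_less_trans[OF sup_norm_iter_deriv_fseries_le[OF rc] small]
      by simp
    with ball have "norm (u (fseries ?c)) < e" by auto
    moreover have "fseries a = (\<lambda>x. fseries ?b x + fseries ?c x)"
      using c_eq by (simp add: fun_eq_iff)
    then have "u (fseries a) = u (fseries ?b) + u (fseries ?c)"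
      using distribution_add[OF u fseries_in_test[OF rb] fseries_in_test[OF rc]] by simp
    ultimately show "dist (\<Sum>k\<in>F. a k * u (character k)) (u (fseries a)) < e"
      using distribution_finite_fseries[OF u a F(2)] by (simp add: dist_norm norm_minus_commute)
  qed
qed

section \<open>Fourier coefficients of test functions\<close>

abbreviation unit_square :: "point set" where
  "unit_square \<equiv> cbox (0, 0) (1, 1)"

lemma unit_square_translate: "\<exists>y \<in> unit_square. \<exists>k. x = y + ivec k"
  by (intro bexI[of _ "(frac (fst x), frac (snd x))"] exI[of _ "(\<lfloor>fst x\<rfloor>, \<lfloor>snd x\<rfloor>)"])
    (auto simp: cbox_Pair_eq ivec_def prod_eq_iff less_imp_le[OF frac_lt_1], simp_all add: frac_def)

lemma periodic_bounded:
  assumes "periodic \<phi>" "continuous_on UNIV \<phi>"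
  shows "bdd_above (range (\<lambda>x. norm (\<phi> x)))"
proof -
  have "compact ((\<lambda>x. norm (\<phi> x)) ` unit_square)"
    by (intro compact_continuous_image continuous_on_norm continuous_on_subset[OF assms(2)]) auto
  then have "bdd_above ((\<lambda>x. norm (\<phi> x)) ` unit_square)"
    by (intro bounded_imp_bdd_above compact_imp_bounded)
  moreover have "range (\<lambda>x. norm (\<phi> x)) \<subseteq> (\<lambda>x. norm (\<phi> x)) ` unit_square"
  proof clarify
    fix x show "norm (\<phi> x) \<in> (\<lambda>x. norm (\<phi> x)) ` unit_square"
      using unit_square_translate[of x] assms(1) unfolding periodic_def by (metis imageI)
  qed
  ultimately show ?thesis by (rule bdd_above_mono)
qed

lemma norm_le_sup_norm:
  assumes "periodic \<phi>" "continuous_on UNIV \<phi>"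
  shows "norm (\<phi> x) \<le> sup_norm \<phi>"
  unfolding sup_norm_def by (rule cSUP_upper[OF UNIV_I periodic_bounded[OF assms]])

lemma continuous_on_character: "continuous_on S (character k)"
  by (intro has_derivative_continuous_on[of _ _ "\<lambda>x h. dsymbol h k * character k x"])
    (use character_has_derivative[of 1 k] in \<open>auto simp: dsymbol_def intro: has_derivative_at_withinI\<close>)

lemma norm_integral_unit_square_le:
  fixes g :: "point \<Rightarrow> complex"
  assumes "continuous_on unit_square g" "\<And>x. norm (g x) \<le> B"
  shows "norm (integral unit_square g) \<le> B"
proof -
  have "B \<ge> 0" using order_trans[OF norm_ge_zero assms(2)] .
  then show ?thesis
    using has_integral_bound[OF _ integrable_integral[OF integrable_continuous[OF assms(1)]], of B] assms(2)
    by (simp add: content_Pair)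
qed

definition fcoeff :: "(point \<Rightarrow> complex) \<Rightarrow> freq \<Rightarrow> complex" where
  "fcoeff \<phi> k = integral unit_square (\<lambda>x. character (- k) x * \<phi> x)"

lemma integrable_unit_square:
  fixes \<phi> :: "point \<Rightarrow> complex"
  shows "continuous_on UNIV \<phi> \<Longrightarrow> \<phi> integrable_on unit_square"
  by (rule integrable_continuous) (erule continuous_on_subset, simp)

lemma continuous_character_mult:
  "continuous_on UNIV \<phi> \<Longrightarrow> continuous_on UNIV (\<lambda>x. character k x * \<phi> x)"
  by (intro continuous_on_mult continuous_on_character)

lemma norm_fcoeff_le:
  assumes "periodic \<phi>" "continuous_on UNIV \<phi>"
  shows "norm (fcoeff \<phi> k) \<le> sup_norm \<phi>"
  unfolding fcoeff_def
  by (rule norm_integral_unit_square_le)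
    (auto intro: continuous_on_subset[OF continuous_character_mult[OF assms(2)]]
       simp: norm_mult norm_le_sup_norm[OF assms])

lemma fcoeff_add:
  assumes "continuous_on UNIV \<phi>" "continuous_on UNIV \<psi>"
  shows "fcoeff (\<lambda>x. \<phi> x + \<psi> x) k = fcoeff \<phi> k + fcoeff \<psi> k"
  unfolding fcoeff_def distrib_left
  by (intro integral_add integrable_unit_square continuous_character_mult assms)

lemma fcoeff_diff:
  assumes "continuous_on UNIV \<phi>" "continuous_on UNIV \<psi>"
  shows "fcoeff (\<lambda>x. \<phi> x - \<psi> x) k = fcoeff \<phi> k - fcoeff \<psi> k"
  unfolding fcoeff_def right_diff_distrib
  by (intro integral_diff integrable_unit_square continuous_character_mult assms)

lemma fcoeff_scale: "fcoeff (\<lambda>x. c * \<phi> x) k = c * fcoeff \<phi> k"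
  unfolding fcoeff_def by (simp add: mult.left_commute[of _ c])

lemma smooth_differentiable:
  "smooth \<phi> \<Longrightarrow> bs \<in> lists Basis \<Longrightarrow> iter_deriv bs \<phi> differentiable (at x)"
  unfolding smooth_def by (rule spec, rule bspec)

lemma smooth_has_derivative:
  "smooth \<phi> \<Longrightarrow> bs \<in> lists Basis \<Longrightarrow>
    (iter_deriv bs \<phi> has_derivative frechet_derivative (iter_deriv bs \<phi>) (at x)) (at x)"
  by (simp only: smooth_differentiable frechet_derivative_works[symmetric])

lemma iter_deriv_has_derivative:
  assumes "\<phi> \<in> test_functions" "bs \<in> lists Basis"
  shows "(iter_deriv bs \<phi> has_derivative frechet_derivative (iter_deriv bs \<phi>) (at x)) (at x)"
  using assms by (intro smooth_has_derivative) (simp_all add: test_functions_def)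

lemma iter_deriv_lincomb:
  assumes \<phi>: "smooth \<phi>" and \<psi>: "smooth \<psi>" and bs: "bs \<in> lists Basis"
  shows "iter_deriv bs (\<lambda>x. \<phi> x + c * \<psi> x) = (\<lambda>x. iter_deriv bs \<phi> x + c * iter_deriv bs \<psi> x)"
  using bs
proof (induction bs)
  case (Cons b bs)
  then have bs: "bs \<in> lists Basis" by simp
  have "((\<lambda>x. iter_deriv bs \<phi> x + c * iter_deriv bs \<psi> x) has_derivative
      (\<lambda>h. frechet_derivative (iter_deriv bs \<phi>) (at x) h +
           c * frechet_derivative (iter_deriv bs \<psi>) (at x) h)) (at x)" for x
    by (intro has_derivative_add has_derivative_mult_right smooth_has_derivative \<phi> \<psi> bs)
  from frechet_derivative_at[OF this, symmetric] show ?case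
    by (simp add: Cons.IH)
qed simp

lemma test_function_lincomb:
  assumes "\<phi> \<in> test_functions" "\<psi> \<in> test_functions"
  shows "(\<lambda>x. \<phi> x + c * \<psi> x) \<in> test_functions"
proof -
  from assms have s: "smooth \<phi>" "smooth \<psi>" and p: "periodic \<phi>" "periodic \<psi>"
    by (simp_all add: test_functions_def)
  have "smooth (\<lambda>x. \<phi> x + c * \<psi> x)"
    unfolding smooth_def
  proof (intro ballI allI)
    fix bs x assume bs: "bs \<in> lists (Basis :: point set)"
    show "iter_deriv bs (\<lambda>x. \<phi> x + c * \<psi> x) differentiable at x"
      unfolding iter_deriv_lincomb[OF s bs]
      by (intro differentiable_add differentiable_mult smooth_differentiable s bs) simp
  qed
  with p show ?thesis unfolding test_functions_def periodic_def by simp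
qed

lemma test_function_add:
  "\<phi> \<in> test_functions \<Longrightarrow> \<psi> \<in> test_functions \<Longrightarrow> (\<lambda>x. \<phi> x + \<psi> x) \<in> test_functions"
  using test_function_lincomb[of \<phi> \<psi> 1] by simp

lemma test_function_diff:
  "\<phi> \<in> test_functions \<Longrightarrow> \<psi> \<in> test_functions \<Longrightarrow> (\<lambda>x. \<phi> x - \<psi> x) \<in> test_functions"
  using test_function_lincomb[of \<phi> \<psi> "-1"] by simp

lemma test_function_scale:
  "\<phi> \<in> test_functions \<Longrightarrow> (\<lambda>x. c * \<phi> x) \<in> test_functions"
  using test_function_lincomb[of \<phi> \<phi> "c - 1"] by (simp add: algebra_simps)

lemma continuous_iter_deriv:
  assumes "\<phi> \<in> test_functions" "bs \<in> lists Basis"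
  shows "continuous_on S (iter_deriv bs \<phi>)"
  by (rule has_derivative_continuous_on)
    (rule has_derivative_at_withinI[OF iter_deriv_has_derivative[OF assms]])

lemma continuous_test_function: "\<phi> \<in> test_functions \<Longrightarrow> continuous_on S \<phi>"
  using continuous_iter_deriv[of \<phi> "[]"] by simp

lemma periodic_iter_deriv:
  assumes "\<phi> \<in> test_functions" "bs \<in> lists Basis"
  shows "periodic (iter_deriv bs \<phi>)"
  using assms(2)
proof (induction bs)
  case Nil
  then show ?case using assms(1) by (simp add: test_functions_def)
next
  case (Cons b bs)
  then have bs: "bs \<in> lists Basis" and per: "periodic (iter_deriv bs \<phi>)" by auto
  show ?case
    unfolding periodic_def
  proof (intro allI)
    fix x k
    have "((\<lambda>y. y + ivec k) has_derivative (\<lambda>h. h)) (at x)"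
      by (auto intro!: derivative_eq_intros)
    from has_derivative_compose[OF this iter_deriv_has_derivative[OF assms(1) bs]]
    have "((\<lambda>y. iter_deriv bs \<phi> (y + ivec k)) has_derivative
        frechet_derivative (iter_deriv bs \<phi>) (at (x + ivec k))) (at x)" .
    then have "(iter_deriv bs \<phi> has_derivative
        frechet_derivative (iter_deriv bs \<phi>) (at (x + ivec k))) (at x)"
      by (simp only: per[unfolded periodic_def, rule_format])
    from frechet_derivative_at[OF this]
    show "iter_deriv (b # bs) \<phi> (x + ivec k) = iter_deriv (b # bs) \<phi> x" by simp
  qed
qed

text \<open>Integrating a derivative along a closed geodesic of the torus gives the increment of the
  function, which vanishes by periodicity.\<close>

lemma integral_line_derivative:
  fixes \<psi> :: "point \<Rightarrow> complex"
  assumes \<psi>: "\<And>x. (\<psi> has_derivative \<psi>' x) (at x)" and per: "periodic \<psi>"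
  shows "integral (cbox 0 1) (\<lambda>t. \<psi>' (x + t *\<^sub>R ivec l) (ivec l)) = 0"
proof -
  have "((\<lambda>t. \<psi>' (x + t *\<^sub>R ivec l) (ivec l)) has_integral
      \<psi> (x + 1 *\<^sub>R ivec l) - \<psi> (x + 0 *\<^sub>R ivec l)) {0..1}"
  proof (rule fundamental_theorem_of_calculus)
    fix t :: real
    let ?y = "x + t *\<^sub>R ivec l"
    have "((\<lambda>t. x + t *\<^sub>R ivec l) has_derivative (\<lambda>h. h *\<^sub>R ivec l)) (at t within {0..1})"
      by (auto intro!: derivative_eq_intros)
    from has_derivative_compose[OF this \<psi>[of ?y]]
    show "((\<lambda>t. \<psi> (x + t *\<^sub>R ivec l)) has_vector_derivative \<psi>' ?y (ivec l)) (at t within {0..1})"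
      unfolding has_vector_derivative_def
      using linear_scale[OF has_derivative_linear[OF \<psi>[of ?y]]] by simp
  qed simp
  moreover have "\<psi> (x + 1 *\<^sub>R ivec l) = \<psi> x"
    using per by (simp add: periodic_def)
  ultimately show ?thesis by (simp add: integral_unique)
qed

lemma integral_torus_derivative:
  fixes \<psi> :: "point \<Rightarrow> complex"
  assumes \<psi>: "\<And>x. (\<psi> has_derivative \<psi>' x) (at x)"
    and per: "periodic \<psi>" and b: "b \<in> Basis" and cont: "continuous_on UNIV (\<lambda>x. \<psi>' x b)"
  shows "integral unit_square (\<lambda>x. \<psi>' x b) = 0"
proof -
  have cont': "continuous_on S (\<lambda>x. \<psi>' x b)" for S
    using cont by (rule continuous_on_subset) simp
  note line = integral_line_derivative[of \<psi> \<psi>', OF \<psi> per]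
  have iterated: "integral unit_square (\<lambda>x. \<psi>' x b) =
      integral (cbox 0 1) (\<lambda>s. integral (cbox 0 1) (\<lambda>t. \<psi>' (s, t) b))"
    by (rule integral_prod_continuous[OF cont'])
  from b have "b = (1, 0) \<or> b = (0, 1)"
    by (auto simp: Basis_prod_def)
  then show ?thesis
  proof
    assume b: "b = (1, 0)"
    have "integral (cbox 0 1) (\<lambda>s. \<psi>' (s, t) b) = 0" for t
      using line[of "(0, t)" "(1, 0)"] by (simp add: b ivec_def)
    moreover have "integral (cbox 0 1) (\<lambda>s. integral (cbox 0 1) (\<lambda>t. \<psi>' (s, t) b)) =
        integral (cbox 0 1) (\<lambda>t. integral (cbox 0 1) (\<lambda>s. \<psi>' (s, t) b))"
      by (rule integral_swap_continuous) (simp add: case_prod_unfold cont')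
    ultimately show ?thesis by (simp only: iterated integral_0)
  next
    assume b: "b = (0, 1)"
    have "integral (cbox 0 1) (\<lambda>t. \<psi>' (s, t) b) = 0" for s
      using line[of "(s, 0)" "(0, 1)"] by (simp add: b ivec_def)
    then show ?thesis by (simp only: iterated integral_0)
  qed
qed

lemma character_derivative:
  "(character k has_derivative (\<lambda>h. dsymbol h k * character k x)) (at x)"
  using character_has_derivative[of 1 k x] by (simp add: dsymbol_def)

text \<open>Integration by parts: the product of \<open>\<psi>\<close> and a character is periodic, so that the integral of its
  derivative vanishes.\<close>

lemma fcoeff_derivative:
  assumes \<psi>: "\<And>x. (\<psi> has_derivative \<psi>' x) (at x)"
    and per: "periodic \<psi>" and b: "b \<in> Basis" and cont: "continuous_on UNIV (\<lambda>x. \<psi>' x b)"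
  shows "fcoeff (\<lambda>x. \<psi>' x b) k = dsymbol b k * fcoeff \<psi> k"
proof -
  let ?e = "character (- k)"
  have c: "continuous_on UNIV \<psi>"
    by (rule has_derivative_continuous_on[OF \<psi>])
  have "integral unit_square (\<lambda>x. ?e x * \<psi>' x b + dsymbol b (- k) * ?e x * \<psi> x) = 0"
  proof (rule integral_torus_derivative[where \<psi> = "\<lambda>x. ?e x * \<psi> x" and b = b
        and \<psi>' = "\<lambda>x h. ?e x * \<psi>' x h + dsymbol h (- k) * ?e x * \<psi> x"])
    show "((\<lambda>x. ?e x * \<psi> x) has_derivative
        (\<lambda>h. ?e x * \<psi>' x h + dsymbol h (- k) * ?e x * \<psi> x)) (at x)" for x
      by (rule has_derivative_mult[OF character_derivative \<psi>])
    show "periodic (\<lambda>x. ?e x * \<psi> x)"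
      using per unfolding periodic_def by (simp only: character_periodic) simp
    show "continuous_on UNIV (\<lambda>x. ?e x * \<psi>' x b + dsymbol b (- k) * ?e x * \<psi> x)"
      by (intro continuous_intros continuous_on_character c cont)
  qed (rule b)
  also have "(\<lambda>x. ?e x * \<psi>' x b + dsymbol b (- k) * ?e x * \<psi> x)
      = (\<lambda>x. ?e x * \<psi>' x b - dsymbol b k * (?e x * \<psi> x))"
    by (simp add: dsymbol_def ivec_def inner_prod_def algebra_simps)
  also have "integral unit_square \<dots> = fcoeff (\<lambda>x. \<psi>' x b) k - dsymbol b k * fcoeff \<psi> k"
    unfolding fcoeff_def
    by (subst integral_diff)
      (auto intro!: integrable_unit_square continuous_intros continuous_on_character c cont)
  finally show ?thesis by simp
qed

lemma fcoeff_iter_deriv: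
  assumes "\<phi> \<in> test_functions" "bs \<in> lists Basis"
  shows "fcoeff (iter_deriv bs \<phi>) k = dsymbols bs k * fcoeff \<phi> k"
  using assms(2)
proof (induction bs)
  case (Cons b bs)
  then have bs: "bs \<in> lists Basis" and b: "b \<in> Basis" by auto
  have "fcoeff (iter_deriv (b # bs) \<phi>) k = dsymbol b k * fcoeff (iter_deriv bs \<phi>) k"
    unfolding iter_deriv.simps
    by (rule fcoeff_derivative[OF iter_deriv_has_derivative[OF assms(1) bs]
          periodic_iter_deriv[OF assms(1) bs] b])
      (use continuous_iter_deriv[OF assms(1), of "b # bs" UNIV] b bs in simp)
  with Cons.IH bs show ?case by (simp add: mult.assoc)
qed simp

text \<open>The coefficient is multiplied by \<open>2\<pi>ik\<^sub>j\<close> under a derivative in the \<open>j\<close>-th variable, so \<open>M\<close>-fold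
  derivatives in one variable control \<open>|k\<^sub>j|\<^sup>M\<close> times the coefficient.  The explicit constant is what
  makes functionals given by coefficients continuous.\<close>

lemma fcoeff_decay:
  assumes \<phi>: "\<phi> \<in> test_functions"
    and B: "\<And>bs. bs \<in> lists Basis \<Longrightarrow> length bs \<le> M \<Longrightarrow> sup_norm (iter_deriv bs \<phi>) \<le> B"
  shows "norm (fcoeff \<phi> k) * japanese k ^ M \<le> 3 ^ M * B"
proof -
  have coord: "norm (dsymbol b k) ^ j * norm (fcoeff \<phi> k) \<le> B" if "b \<in> Basis" "j \<le> M" for b j
  proof -
    have bs: "replicate j b \<in> lists Basis" using that by (auto simp: in_lists_conv_set)
    have "dsymbols (replicate j b) k = dsymbol b k ^ j" by (induction j) simp_all
    then have "norm (dsymbol b k) ^ j * norm (fcoeff \<phi> k) = norm (fcoeff (iter_deriv (replicate j b) \<phi>) k)"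
      by (simp add: fcoeff_iter_deriv[OF \<phi> bs] norm_mult norm_power)
    also have "\<dots> \<le> sup_norm (iter_deriv (replicate j b) \<phi>)"
      by (rule norm_fcoeff_le[OF periodic_iter_deriv[OF \<phi> bs] continuous_iter_deriv[OF \<phi> bs]])
    also have "\<dots> \<le> B" by (rule B[OF bs]) (use that in simp)
    finally show ?thesis .
  qed
  define p where "p = \<bar>real_of_int (fst k)\<bar>"
  define q where "q = \<bar>real_of_int (snd k)\<bar>"
  have basis: "(1, 0) \<in> (Basis :: point set)" "(0, 1) \<in> (Basis :: point set)"
    by (auto simp: Basis_prod_def)
  have p: "p \<le> norm (dsymbol (1, 0) k)" and q: "q \<le> norm (dsymbol (0, 1) k)"
  proof -
    have "1 * p \<le> (2 * pi) * p" "1 * q \<le> (2 * pi) * q"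
      using pi_ge_two by (intro mult_right_mono; simp add: p_def q_def)+
    then show "p \<le> norm (dsymbol (1, 0) k)" "q \<le> norm (dsymbol (0, 1) k)"
      by (simp_all add: dsymbol_def norm_mult ivec_def p_def q_def)
  qed
  have pq0: "p \<ge> 0" "q \<ge> 0" by (simp_all add: p_def q_def)
  have "(japanese k)\<^sup>2 \<le> (1 + p + q)\<^sup>2"
    using pq0 unfolding japanese_power2
    by (simp add: p_def q_def power2_eq_square algebra_simps flip: abs_mult)
  then have "japanese k \<le> 1 + p + q"
    by (rule power2_le_imp_le) (use pq0 in simp)
  \<comment> \<open>the larger coordinate, or \<open>1\<close>, dominates \<open>\<langle>k\<rangle>\<close> up to the factor \<open>3\<close>\<close>
  then have jmax: "japanese k \<le> 3 * max 1 (max p q)" by linarith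
  have "max 1 (max p q) ^ M * norm (fcoeff \<phi> k) \<le> B"
  proof -
    have "p ^ M * norm (fcoeff \<phi> k) \<le> B"
      using order_trans[OF mult_right_mono[OF power_mono[OF p pq0(1)]] coord[OF basis(1) order_refl]]
      by simp
    moreover have "q ^ M * norm (fcoeff \<phi> k) \<le> B"
      using order_trans[OF mult_right_mono[OF power_mono[OF q pq0(2)]] coord[OF basis(2) order_refl]]
      by simp
    moreover have "norm (fcoeff \<phi> k) \<le> B"
      using coord[OF basis(1), of 0] by simp
    ultimately show ?thesis by (auto simp: max_def)
  qed
  then have "3 ^ M * (max 1 (max p q) ^ M * norm (fcoeff \<phi> k)) \<le> 3 ^ M * B"
    by (rule mult_left_mono) simp
  moreover have "japanese k ^ M \<le> (3 * max 1 (max p q)) ^ M"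
    by (rule power_mono[OF jmax]) (use japanese_pos[of k] in simp)
  then have "japanese k ^ M * norm (fcoeff \<phi> k) \<le> (3 * max 1 (max p q)) ^ M * norm (fcoeff \<phi> k)"
    by (rule mult_right_mono) simp
  ultimately show ?thesis by (simp only: power_mult_distrib mult.assoc mult.commute[of "norm _"])
qed

lemma rapid_fcoeff:
  assumes \<phi>: "\<phi> \<in> test_functions"
  shows "rapid (fcoeff \<phi>)"
  unfolding rapid_def
proof
  fix M
  let ?S = "{bs \<in> lists (Basis :: point set). length bs \<le> M}"
  have fin: "finite ?S"
    using finite_lists_length_le[of "Basis :: point set" M]
    by (simp add: in_lists_conv_set subset_eq del: split_paired_All)
  let ?B = "\<Sum>bs\<in>?S. \<bar>sup_norm (iter_deriv bs \<phi>)\<bar>"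
  have "sup_norm (iter_deriv bs \<phi>) \<le> ?B" if "bs \<in> lists Basis" "length bs \<le> M" for bs
    using member_le_sum[OF _ _ fin, of bs "\<lambda>bs. \<bar>sup_norm (iter_deriv bs \<phi>)\<bar>"] that by auto
  from fcoeff_decay[OF \<phi> this]
  show "\<exists>C. \<forall>k. norm (fcoeff \<phi> k) * japanese k ^ M \<le> C" by blast
qed

lemma integral_character: "integral unit_square (character k) = (if k = 0 then 1 else 0)"
proof (cases "k = 0")
  case True
  then have "character k = (\<lambda>_. 1)" by (simp add: fun_eq_iff)
  then show ?thesis using True by (simp add: content_Pair)
next
  case False
  obtain b where b: "b \<in> Basis" "dsymbol b k \<noteq> 0"
  proof (cases "fst k = 0")
    case True
    with False have "snd k \<noteq> 0" by (simp add: prod_eq_iff)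
    then show ?thesis by (intro that[of "(0, 1)"]) (auto simp: Basis_prod_def dsymbol_def ivec_def)
  next
    case False
    then show ?thesis by (intro that[of "(1, 0)"]) (auto simp: Basis_prod_def dsymbol_def ivec_def)
  qed
  have "integral unit_square (\<lambda>x. dsymbol b k * character k x) = 0"
    by (rule integral_torus_derivative[OF character_derivative _ b(1)])
      (auto simp: periodic_def character_periodic intro!: continuous_intros continuous_on_character)
  then show ?thesis using b(2) False by simp
qed

lemma dist_of_character: "\<phi> \<in> test_functions \<Longrightarrow> dist_of_fun (character k) \<phi> = fcoeff \<phi> (- k)"
  by (simp add: dist_of_fun_def fcoeff_def)

lemma dist_of_character_in_distributions: "dist_of_fun (character k) \<in> distributions"
proof (rule distributionI[where M = 0 and C = 1])
  note cont = continuous_test_function[of _ UNIV]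
  let ?u = "dist_of_fun (character k)"
  show "?u \<in> extensional test_functions" by (simp add: dist_of_fun_def)
  fix \<phi> assume \<phi>: "\<phi> \<in> test_functions"
  { fix \<psi> assume \<psi>: "\<psi> \<in> test_functions"
    show "?u (\<lambda>x. \<phi> x + \<psi> x) = ?u \<phi> + ?u \<psi>"
      by (simp only: dist_of_character test_function_add \<phi> \<psi> fcoeff_add[OF cont cont]) }
  show "?u (\<lambda>x. c * \<phi> x) = c * ?u \<phi>" for c
    by (simp only: dist_of_character test_function_scale \<phi> fcoeff_scale)
  fix \<psi> \<delta> assume "\<psi> \<in> test_ball 0 \<delta> \<phi>"
  then have \<psi>: "\<psi> \<in> test_functions" and sup: "sup_norm (\<lambda>x. \<psi> x - \<phi> x) < \<delta>"
    by (auto simp: test_ball_def dest: bspec[of _ _ "[]"])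
  have d: "(\<lambda>x. \<psi> x - \<phi> x) \<in> test_functions" by (rule test_function_diff[OF \<psi> \<phi>])
  have "norm (fcoeff (\<lambda>x. \<psi> x - \<phi> x) (- k)) \<le> sup_norm (\<lambda>x. \<psi> x - \<phi> x)"
    using d by (intro norm_fcoeff_le cont) (simp_all add: test_functions_def)
  then show "norm (?u \<psi> - ?u \<phi>) \<le> 1 * \<delta>"
    using sup by (simp add: dist_of_character \<phi> \<psi> fcoeff_diff[OF cont cont])
qed

text \<open>The coefficient at \<open>k\<close> is itself a distribution, so it can be taken term by term; orthogonality
  of the characters leaves a single term.\<close>

lemma fcoeff_fseries:
  assumes a: "rapid a"
  shows "fcoeff (fseries a) k = a k"
proof -
  have fourier_pair: "dist_of_fun (character (- k)) (character l) = (if l = k then 1 else 0)" for l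
    by (simp add: dist_of_character character_in_test fcoeff_def integral_character flip: character_add_freq)
  have "((\<lambda>l. a l * dist_of_fun (character (- k)) (character l)) has_sum
      dist_of_fun (character (- k)) (fseries a)) UNIV"
    by (rule distribution_fseries[OF dist_of_character_in_distributions a])
  moreover have "((\<lambda>l. a l * dist_of_fun (character (- k)) (character l)) has_sum a k) UNIV"
    using has_sum_restrict_finite[of "{k}" a] by (simp add: fourier_pair if_distrib cong: if_cong)
  ultimately have "dist_of_fun (character (- k)) (fseries a) = a k"
    by (rule has_sum_unique)
  then show ?thesis by (simp add: dist_of_character fseries_in_test[OF a])
qed

section \<open>Completeness of the characters\<close>

text \<open>The functions \<open>g\<close> whose product with every continuous function orthogonal to all characters
  is again orthogonal to all characters form an algebra, so that it suffices to look at generators.\<close>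

definition multiplier :: "(point \<Rightarrow> complex) \<Rightarrow> bool" where
  "multiplier g \<longleftrightarrow> continuous_on UNIV g \<and> (\<forall>D. continuous_on UNIV D \<longrightarrow>
     (\<forall>k. fcoeff D k = 0) \<longrightarrow> (\<forall>k. fcoeff (\<lambda>x. g x * D x) k = 0))"

lemma multiplier_character: "multiplier (character l)"
  unfolding multiplier_def
proof (intro conjI allI impI)
  fix D k assume D: "\<forall>k. fcoeff D k = 0"
  have "fcoeff (\<lambda>x. character l x * D x) k = fcoeff D (k - l)"
    unfolding fcoeff_def by (simp flip: mult.assoc character_add_freq)
  with D show "fcoeff (\<lambda>x. character l x * D x) k = 0" by simp
qed (rule continuous_on_character)

lemma multiplier_mult: "multiplier g \<Longrightarrow> multiplier h \<Longrightarrow> multiplier (\<lambda>x. g x * h x)"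
  unfolding multiplier_def by (simp add: continuous_on_mult mult.assoc)

lemma multiplier_scale: "multiplier g \<Longrightarrow> multiplier (\<lambda>x. c * g x)"
  unfolding multiplier_def by (simp add: continuous_on_mult mult.assoc fcoeff_scale)

lemma multiplier_add: "multiplier g \<Longrightarrow> multiplier h \<Longrightarrow> multiplier (\<lambda>x. g x + h x)"
  unfolding multiplier_def by (simp add: continuous_on_add continuous_on_mult distrib_right fcoeff_add)

text \<open>The torus embedded in \<open>\<complex>\<^sup>2\<close>, where polynomials restrict to trigonometric polynomials.\<close>

definition torus_map :: "point \<Rightarrow> complex \<times> complex" where
  "torus_map x = (cis (2 * pi * fst x), cis (2 * pi * snd x))"

lemma continuous_torus_map: "continuous_on S torus_map"
  unfolding torus_map_def cis_conv_exp by (intro continuous_intros)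

lemma torus_map_eqD:
  assumes "torus_map x = torus_map y"
  shows "\<exists>k. x = y + ivec k"
proof -
  have "\<exists>n::int. s = t + n" if "cis (2 * pi * s) = cis (2 * pi * t)" for s t
  proof -
    from that have "sin (2 * pi * s) = sin (2 * pi * t) \<and> cos (2 * pi * s) = cos (2 * pi * t)"
      by (simp add: complex_eq_iff)
    then obtain n :: int where "2 * pi * s = 2 * pi * t + 2 * pi * n"
      unfolding sin_cos_eq_iff by blast
    then have "s = t + n" by (simp flip: distrib_left)
    then show ?thesis ..
  qed
  with assms obtain m n :: int where "fst x = fst y + m" "snd x = snd y + n"
    unfolding torus_map_def by blast
  then show ?thesis by (intro exI[of _ "(m, n)"]) (simp add: ivec_def prod_eq_iff)
qed

lemma ivec_minus: "ivec (- k) = - ivec k"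
  by (simp add: ivec_def)

lemma multiplier_polynomial:
  assumes "real_polynomial_function p"
  shows "multiplier (\<lambda>x. of_real (p (torus_map x)))"
  using assms
proof induction
  case (const c)
  show ?case using multiplier_scale[OF multiplier_character[of 0], of "of_real c"] by simp
next
  case (linear f)
  interpret bounded_linear f by fact
  let ?c = "\<lambda>l x. character l x + character (- l) x"
  let ?s = "\<lambda>l x. character l x + (- 1) * character (- l) x"
  have sc: "of_real (cos (2 * pi * (ivec l \<bullet> x))) = (1 / 2) * ?c l x"
    "of_real (sin (2 * pi * (ivec l \<bullet> x))) = (- \<i> / 2) * ?s l x" for l x
    by (simp_all add: character_eq_cis complex_eq_iff ivec_minus)
  have "of_real (f (torus_map x)) =
      of_real (f (1, 0)) * ((1 / 2) * ?c (1, 0) x) + of_real (f (\<i>, 0)) * ((- \<i> / 2) * ?s (1, 0) x) +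
      (of_real (f (0, 1)) * ((1 / 2) * ?c (0, 1) x) + of_real (f (0, \<i>)) * ((- \<i> / 2) * ?s (0, 1) x))"
    for x
  proof -
    define s t where "s = 2 * pi * fst x" and "t = 2 * pi * snd x"
    have "torus_map x = (cos s *\<^sub>R (1, 0) + sin s *\<^sub>R (\<i>, 0)) + (cos t *\<^sub>R (0, 1) + sin t *\<^sub>R (0, \<i>))"
      by (simp add: torus_map_def s_def t_def complex_eq_iff)
    then have "f (torus_map x) = (cos s * f (1, 0) + sin s * f (\<i>, 0)) + (cos t * f (0, 1) + sin t * f (0, \<i>))"
      by (simp only: add scaleR real_scaleR_def)
    then show ?thesis
      unfolding sc[symmetric] by (simp add: s_def t_def ivec_def inner_prod_def mult.commute)
  qed
  moreover have "multiplier (\<lambda>x.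
      of_real (f (1, 0)) * ((1 / 2) * ?c (1, 0) x) + of_real (f (\<i>, 0)) * ((- \<i> / 2) * ?s (1, 0) x) +
      (of_real (f (0, 1)) * ((1 / 2) * ?c (0, 1) x) + of_real (f (0, \<i>)) * ((- \<i> / 2) * ?s (0, 1) x)))"
    by (intro multiplier_add multiplier_scale multiplier_character)
  ultimately show ?case by simp
next
  case (add f g)
  then show ?case by (simp add: multiplier_add)
next
  case (mult f g)
  then show ?case by (simp add: multiplier_mult)
qed

text \<open>The unit square is compact and \<open>torus_map\<close> identifies exactly the points that differ by an
  integer vector; so a periodic continuous function descends to a continuous function on the image.\<close>

lemma torus_factorization:
  fixes R :: "point \<Rightarrow> real"
  assumes cont: "continuous_on UNIV R" and per: "\<And>x k. R (x + ivec k) = R x"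
  obtains G where "continuous_on (torus_map ` unit_square) G" "\<And>x. x \<in> unit_square \<Longrightarrow> G (torus_map x) = R x"
proof
  define G where "G = (\<lambda>z. R (SOME y. y \<in> unit_square \<and> torus_map y = z))"
  show G: "G (torus_map x) = R x" if "x \<in> unit_square" for x
  proof -
    let ?y = "SOME y. y \<in> unit_square \<and> torus_map y = torus_map x"
    have "?y \<in> unit_square \<and> torus_map ?y = torus_map x"
      by (rule someI[of _ x]) (use that in simp)
    then obtain k where "?y = x + ivec k" using torus_map_eqD by blast
    then show ?thesis unfolding G_def by (simp only: per)
  qed
  have "closed (torus_map ` unit_square)"
    by (intro compact_imp_closed compact_continuous_image continuous_torus_map) simp
  moreover have "closed (G -` B \<inter> torus_map ` unit_square)" if B: "closed B" for B
  proof -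
    have "G -` B \<inter> torus_map ` unit_square = torus_map ` (unit_square \<inter> R -` B)"
      using G by (auto simp del: split_paired_All split_paired_Ex)
    moreover have "compact (unit_square \<inter> R -` B)"
      using continuous_closed_vimage[of B R] B cont
      by (intro compact_Int_closed) (auto simp: continuous_on_eq_continuous_at)
    ultimately show ?thesis
      by (metis compact_continuous_image compact_imp_closed continuous_torus_map)
  qed
  ultimately show "continuous_on (torus_map ` unit_square) G"
    by (simp add: continuous_on_closed_vimage)
qed

text \<open>By the Stone-Weierstrass theorem \<open>R = Re D\<close> is uniformly approximated on the torus by real
  polynomials \<open>p\<close>.  As these are multipliers, the integral of \<open>D p\<close> vanishes and so does its real part,
  the integral of \<open>R p\<close>.  Hence the integral of \<open>R\<^sup>2\<close> equals that of \<open>R (R - p)\<close>, which is arbitrarily small.\<close>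

lemma vanishing_fcoeff_Re:
  assumes cont: "continuous_on UNIV D" and per: "periodic D" and 0: "\<And>k. fcoeff D k = 0"
    and x: "x \<in> unit_square"
  shows "Re (D x) = 0"
proof -
  let ?R = "\<lambda>x. Re (D x)"
  have contR: "continuous_on UNIV ?R" by (intro continuous_intros cont)
  note contR' = continuous_on_subset[OF contR subset_UNIV]
  obtain G where G: "continuous_on (torus_map ` unit_square) G"
    "\<And>x. x \<in> unit_square \<Longrightarrow> G (torus_map x) = ?R x"
    using torus_factorization[OF contR] per unfolding periodic_def by metis
  define B where "B = sup_norm D"
  have B: "\<bar>?R x\<bar> \<le> B" for x
    using norm_le_sup_norm[OF per cont, of x] abs_Re_le_cmod[of "D x"] by (simp add: B_def)
  have sq: "continuous_on UNIV (\<lambda>x. ?R x * ?R x)" by (intro continuous_intros cont)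
  have "integral unit_square (\<lambda>x. ?R x * ?R x) \<le> B * e" if "e > 0" for e
  proof -
    obtain p where p: "real_polynomial_function p"
      and close: "\<And>z. z \<in> torus_map ` unit_square \<Longrightarrow> \<bar>G z - p z\<bar> < e"
      using Stone_Weierstrass_real_polynomial_function[OF _ G(1) \<open>e > 0\<close>]
      by (metis compact_cbox compact_continuous_image continuous_torus_map)
    let ?p = "\<lambda>x. p (torus_map x)"
    have mult: "multiplier (\<lambda>x. of_real (?p x))" by (rule multiplier_polynomial[OF p])
    then have contpC: "continuous_on UNIV (\<lambda>x. complex_of_real (?p x))" by (simp add: multiplier_def)
    have contp: "continuous_on UNIV ?p"
      using continuous_on_Re[OF contpC] by simp
    have "fcoeff (\<lambda>x. of_real (?p x) * D x) 0 = 0"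
      using mult cont 0 by (simp add: multiplier_def)
    then have "integral unit_square (\<lambda>x. of_real (?p x) * D x) = 0"
      by (simp add: fcoeff_def)
    moreover have "(\<lambda>x. of_real (?p x) * D x) integrable_on unit_square"
      by (intro integrable_unit_square continuous_on_mult contpC cont)
    ultimately have "((\<lambda>x. of_real (?p x) * D x) has_integral 0) unit_square"
      by (metis integrable_integral)
    from has_integral_linear[OF this bounded_linear_Re]
    have zero: "((\<lambda>x. ?p x * ?R x) has_integral 0) unit_square" by (simp add: o_def)
    have "(\<lambda>x. ?R x * ?R x) integrable_on unit_square"
      by (rule integrable_continuous[OF continuous_on_subset[OF sq]]) simp
    from has_integral_diff[OF integrable_integral[OF this] zero]
    have int: "((\<lambda>x. (?R x - ?p x) * ?R x) has_integral integral unit_square (\<lambda>x. ?R x * ?R x)) unit_square"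
      by (simp add: algebra_simps)
    have const: "((\<lambda>_::point. B * e) has_integral B * e) unit_square"
      using has_integral_const[of "B * e" "(0, 0)" "(1, 1) :: point"] by (simp add: content_Pair)
    show ?thesis
    proof (rule has_integral_le[OF int const])
      fix x assume x: "x \<in> unit_square"
      have "\<bar>?R x - ?p x\<bar> \<le> e" using close[of "torus_map x"] G(2)[OF x] x by simp
      then have "\<bar>?R x - ?p x\<bar> * \<bar>?R x\<bar> \<le> e * B"
        using B[of x] \<open>e > 0\<close> by (intro mult_mono) auto
      then show "(?R x - ?p x) * ?R x \<le> B * e"
        by (metis abs_le_D1 abs_mult mult.commute)
    qed
  qed
  then have "integral unit_square (\<lambda>x. ?R x * ?R x) \<le> 0"
  proof -
    assume *: "\<And>e. e > 0 \<Longrightarrow> integral unit_square (\<lambda>x. ?R x * ?R x) \<le> B * e"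
    have "B \<ge> 0" using B[of x] by simp
    show ?thesis
    proof (rule field_le_epsilon)
      fix e :: real assume "e > 0"
      have "integral unit_square (\<lambda>x. ?R x * ?R x) \<le> B * (e / (B + 1))"
        using \<open>B \<ge> 0\<close> \<open>e > 0\<close> by (intro *) simp
      also have "\<dots> \<le> e"
        using \<open>B \<ge> 0\<close> \<open>e > 0\<close> by (simp add: field_simps)
      finally show "integral unit_square (\<lambda>x. ?R x * ?R x) \<le> 0 + e" by simp
    qed
  qed
  moreover have "integral unit_square (\<lambda>x. ?R x * ?R x) \<ge> 0"
    by (rule integral_nonneg[OF integrable_continuous[OF continuous_on_subset[OF sq]]]) auto
  ultimately have "integral unit_square (\<lambda>x. ?R x * ?R x) = 0" by simp
  then have "\<forall>x\<in>unit_square. ?R x * ?R x = 0"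
    by (subst (asm) integral_cbox_eq_0_iff[OF continuous_on_subset[OF sq]])
      (auto simp: box_ne_empty Basis_prod_def)
  with x show ?thesis by auto
qed

lemma vanishing_fcoeff:
  assumes cont: "continuous_on UNIV D" and per: "periodic D" and 0: "\<And>k. fcoeff D k = 0"
  shows "D x = 0"
proof -
  obtain y k where y: "y \<in> unit_square" "x = y + ivec k"
    using unit_square_translate[of x] by blast
  have "Re (D y) = 0" by (rule vanishing_fcoeff_Re[OF cont per 0 y(1)])
  \<comment> \<open>the imaginary part of \<open>D\<close> is the real part of \<open>-\<i>D\<close>\<close>
  moreover have "Re (- \<i> * D y) = 0"
  proof (rule vanishing_fcoeff_Re[OF _ _ _ y(1)])
    show "fcoeff (\<lambda>x. - \<i> * D x) k = 0" for k by (simp only: fcoeff_scale 0 mult_zero_right)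
    show "periodic (\<lambda>x. - \<i> * D x)" using per by (simp add: periodic_def)
  qed (intro continuous_intros cont)
  ultimately have "D y = 0" by (simp add: complex_eq_iff)
  then show ?thesis using per y(2) unfolding periodic_def by simp
qed

text \<open>The difference of the two sides is continuous and all its Fourier coefficients vanish.\<close>

lemma test_function_eq_fseries:
  assumes \<phi>: "\<phi> \<in> test_functions"
  shows "\<phi> = fseries (fcoeff \<phi>)"
proof
  fix x
  let ?D = "\<lambda>x. \<phi> x - fseries (fcoeff \<phi>) x"
  note r = rapid_fcoeff[OF \<phi>]
  have D: "?D \<in> test_functions" by (intro test_function_diff \<phi> fseries_in_test r)
  have "fcoeff ?D k = 0" for k
    by (simp add: fcoeff_diff continuous_test_function \<phi> fseries_in_test r fcoeff_fseries)
  then have "?D x = 0"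
    using D by (intro vanishing_fcoeff[of ?D] continuous_test_function) (simp_all add: test_functions_def)
  then show "\<phi> x = fseries (fcoeff \<phi>) x" by simp
qed

section \<open>Distributions and their Fourier coefficients\<close>

lemma distribution_apply:
  assumes "u \<in> distributions" "\<phi> \<in> test_functions"
  shows "((\<lambda>k. fcoeff \<phi> k * u (character k)) has_sum u \<phi>) UNIV"
  using distribution_fseries[OF assms(1) rapid_fcoeff[OF assms(2)]]
  by (simp flip: test_function_eq_fseries[OF assms(2)])

lemma character_apply_fourier: "u (character k) = fourier u (- k)"
  by (simp add: fourier_def)

lemma distribution_eqI:
  assumes u: "u \<in> distributions" and w: "w \<in> distributions" and eq: "\<And>k. fourier u k = fourier w k"
  shows "u = w"
proof (rule extensionalityI[of _ test_functions])
  fix \<phi> assume \<phi>: "\<phi> \<in> test_functions"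
  show "u \<phi> = w \<phi>"
    using distribution_apply[OF u \<phi>] distribution_apply[OF w \<phi>]
    unfolding character_apply_fourier eq by (rule has_sum_unique)
qed (use u w in \<open>simp_all add: distributions_def\<close>)

text \<open>Pairing with \<open>c (- k)\<close> makes \<open>c k\<close> the Fourier coefficient at \<open>k\<close>, which is the value at the
  character with the opposite frequency.\<close>

definition dist_of_coeffs :: "(freq \<Rightarrow> complex) \<Rightarrow> functional" where
  "dist_of_coeffs c = (\<lambda>\<phi>\<in>test_functions. \<Sum>\<^sub>\<infinity>k. c (- k) * fcoeff \<phi> k)"

lemma moderate_minus:
  assumes "moderate c"
  shows "moderate (\<lambda>k. c (- k))"
  using assms unfolding moderate_def by (metis japanese_minus)

text \<open>If \<open>c\<close> grows like \<open>\<langle>k\<rangle>\<^sup>M\<close>, then derivatives up to order \<open>M + 4\<close> suffice: they compensate the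
  growth of \<open>c\<close> and leave the summable weight \<open>\<langle>k\<rangle>\<^sup>-\<^sup>4\<close>.\<close>

lemma dist_of_coeffs_in_distributions:
  assumes c: "moderate c"
  shows "dist_of_coeffs c \<in> distributions"
proof -
  from moderate_minus[OF c] obtain M C where C: "norm (c (- k)) \<le> C * japanese k ^ M" for k
    unfolding moderate_def by blast
  have C0: "C \<ge> 0"
    using order_trans[OF norm_ge_zero C[of 0]] by simp
  let ?S = "\<Sum>\<^sub>\<infinity>k. 1 / japanese k ^ 4"
  let ?u = "dist_of_coeffs c"
  have summ: "(\<lambda>k. c (- k) * fcoeff \<phi> k) summable_on UNIV" if "\<phi> \<in> test_functions" for \<phi>
    by (rule abs_summable_summable)
      (rule rapid_abs_summable[OF rapid_mult_moderate[OF moderate_minus[OF c] rapid_fcoeff[OF that]]])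
  have u: "?u \<phi> = (\<Sum>\<^sub>\<infinity>k. c (- k) * fcoeff \<phi> k)" if "\<phi> \<in> test_functions" for \<phi>
    using that by (simp add: dist_of_coeffs_def)
  have add: "?u (\<lambda>x. \<phi> x + \<psi> x) = ?u \<phi> + ?u \<psi>"
    if "\<phi> \<in> test_functions" "\<psi> \<in> test_functions" for \<phi> \<psi>
    using that
    by (simp add: u test_function_add fcoeff_add continuous_test_function distrib_left summ infsum_add)
  show ?thesis
  proof (rule distributionI[where M = "M + 4" and C = "C * 3 ^ (M + 4) * ?S"])
    show "?u \<in> extensional test_functions" by (simp add: dist_of_coeffs_def)
  next
    fix d \<phi> assume \<phi>: "\<phi> \<in> test_functions"
    show "?u (\<lambda>x. d * \<phi> x) = d * ?u \<phi>"
      by (simp add: u test_function_scale \<phi> fcoeff_scale mult.left_commute[of _ d] infsum_cmult_right')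
  next
    fix \<phi> \<psi> \<delta> assume \<phi>: "\<phi> \<in> test_functions" and ball: "\<psi> \<in> test_ball (M + 4) \<delta> \<phi>"
    then have \<psi>: "\<psi> \<in> test_functions" by (simp add: test_ball_def)
    define \<eta> where "\<eta> = (\<lambda>x. \<psi> x - \<phi> x)"
    have \<eta>: "\<eta> \<in> test_functions" unfolding \<eta>_def by (rule test_function_diff[OF \<psi> \<phi>])
    have decay: "norm (fcoeff \<eta> k) * japanese k ^ (M + 4) \<le> 3 ^ (M + 4) * \<delta>" for k
      by (rule fcoeff_decay[OF \<eta>]) (use ball in \<open>auto simp: test_ball_def \<eta>_def intro: less_imp_le\<close>)
    have "?u \<psi> = ?u \<eta> + ?u \<phi>"
      using add[OF \<eta> \<phi>] by (simp add: \<eta>_def)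
    then have "?u \<psi> - ?u \<phi> = (\<Sum>\<^sub>\<infinity>k. c (- k) * fcoeff \<eta> k)"
      by (simp add: u[OF \<eta>])
    moreover have "norm (\<Sum>\<^sub>\<infinity>k. c (- k) * fcoeff \<eta> k) \<le> (C * 3 ^ (M + 4) * \<delta>) * ?S"
    proof (rule norm_infsum_le[OF has_sum_infsum[OF summ[OF \<eta>]]])
      show "((\<lambda>k. (C * 3 ^ (M + 4) * \<delta>) * (1 / japanese k ^ 4)) has_sum (C * 3 ^ (M + 4) * \<delta>) * ?S) UNIV"
        by (intro has_sum_cmult_right has_sum_infsum summable_on_inverse_japanese)
      fix k
      have "norm (c (- k) * fcoeff \<eta> k) \<le> (C * japanese k ^ M) * norm (fcoeff \<eta> k)"
        using C[of k] by (simp add: norm_mult mult_right_mono)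
      also have "\<dots> = C * (norm (fcoeff \<eta> k) * japanese k ^ (M + 4)) * (1 / japanese k ^ 4)"
        using japanese_pos[of k] by (simp add: power_add)
      also have "\<dots> \<le> C * (3 ^ (M + 4) * \<delta>) * (1 / japanese k ^ 4)"
        using C0 decay[of k] japanese_pos[of k] by (intro mult_right_mono mult_left_mono) auto
      finally show "norm (c (- k) * fcoeff \<eta> k) \<le> (C * 3 ^ (M + 4) * \<delta>) * (1 / japanese k ^ 4)"
        by (simp only: mult.assoc)
    qed
    ultimately show "norm (?u \<psi> - ?u \<phi>) \<le> C * 3 ^ (M + 4) * ?S * \<delta>"
      by (simp only: mult_ac)
  qed (rule add)
qed

lemma fcoeff_character: "fcoeff (character l) k = (if k = l then 1 else 0)"
  by (auto simp: fcoeff_def integral_character simp flip: character_add_freq)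

lemma fourier_dist_of_coeffs: "fourier (dist_of_coeffs c) k = c k"
proof -
  have "((\<lambda>l. c (- l) * fcoeff (character (- k)) l) has_sum c k) UNIV"
    using has_sum_restrict_finite[of "{- k}" "\<lambda>l. c (- l)"]
    by (simp add: fcoeff_character if_distrib cong: if_cong)
  then show ?thesis
    by (simp add: fourier_def dist_of_coeffs_def character_in_test infsumI)
qed

section \<open>The X-ray transform on the Fourier side\<close>

abbreviation perp :: "freq \<Rightarrow> freq \<Rightarrow> bool" where
  "perp v k \<equiv> fst v * fst k + snd v * snd k = 0"

text \<open>Along the line with direction \<open>v\<close> the character runs through \<open>v \<cdot> k\<close> full periods, which average
  to zero unless there are none.\<close>

lemma xray_fun_character:
  "xray_fun v (character k) x = (if perp v k then 1 else 0) * character k x"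
proof -
  define n where "n = fst v * fst k + snd v * snd k"
  define c where "c = 2 * of_real pi * \<i> * of_int n"
  have shift: "character k (x + t *\<^sub>R ivec v) = exp (t *\<^sub>R c) * character k x" for t
    by (simp add: character_add)
      (simp add: character_def ivec_def inner_prod_def n_def c_def scaleR_conv_of_real algebra_simps)
  have "((\<lambda>t. exp (t *\<^sub>R c)) has_integral (if n = 0 then 1 else 0)) {0..1}"
  proof (cases "n = 0")
    case True
    then show ?thesis using has_integral_const_real[of "1::complex" 0 1] by (simp add: c_def)
  next
    case False
    then have c: "c \<noteq> 0" by (simp add: c_def)
    have "((\<lambda>t. exp (t *\<^sub>R c)) has_integral exp (1 *\<^sub>R c) / c - exp (0 *\<^sub>R c) / c) {0..1}"
    proof (rule fundamental_theorem_of_calculus)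
      fix t :: real
      show "((\<lambda>t. exp (t *\<^sub>R c) / c) has_vector_derivative exp (t *\<^sub>R c)) (at t within {0..1})"
        using has_vector_derivative_divide[OF exp_scaleR_has_vector_derivative_right[of c t "{0..1}"], of c] c
        by simp
    qed simp
    moreover have "exp c = 1"
      using exp_2pi_1_int[of n] by (simp add: c_def mult_ac)
    ultimately show ?thesis using False by simp
  qed
  then have "((\<lambda>t. exp (t *\<^sub>R c) * character k x) has_integral (if n = 0 then 1 else 0) * character k x) {0..1}"
    by (rule has_integral_mult_left)
  then show ?thesis
    unfolding xray_fun_def shift n_def by (rule integral_unique)
qed

lemma continuous_on_line:
  "\<phi> \<in> test_functions \<Longrightarrow> continuous_on {0..1} (\<lambda>t::real. \<phi> (x + t *\<^sub>R ivec v))"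
  by (intro continuous_on_compose2[OF continuous_test_function[of \<phi> UNIV]] continuous_intros) auto

text \<open>The value of the transform at a point depends continuously on the test function, so that
  \<open>distribution_fseries\<close> interchanges the line integral with the Fourier series.\<close>

lemma xray_fun_point_in_distributions:
  "(\<lambda>\<phi>\<in>test_functions. xray_fun v \<phi> x) \<in> distributions" (is "?u \<in> _")
proof (rule distributionI[where M = 0 and C = 1])
  note int = integrable_continuous_real[OF continuous_on_line]
  show "?u \<in> extensional test_functions" by simp
  fix \<phi> assume \<phi>: "\<phi> \<in> test_functions"
  { fix \<psi> assume \<psi>: "\<psi> \<in> test_functions"
    show "?u (\<lambda>x. \<phi> x + \<psi> x) = ?u \<phi> + ?u \<psi>"
      by (simp add: test_function_add \<phi> \<psi> xray_fun_def integral_add int) }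
  show "?u (\<lambda>x. c * \<phi> x) = c * ?u \<phi>" for c
    by (simp add: test_function_scale \<phi> xray_fun_def)
  fix \<psi> \<delta> assume "\<psi> \<in> test_ball 0 \<delta> \<phi>"
  then have \<psi>: "\<psi> \<in> test_functions" and sup: "sup_norm (\<lambda>x. \<psi> x - \<phi> x) < \<delta>"
    by (auto simp: test_ball_def dest: bspec[of _ _ "[]"])
  have d: "(\<lambda>x. \<psi> x - \<phi> x) \<in> test_functions" by (rule test_function_diff[OF \<psi> \<phi>])
  have "norm (xray_fun v (\<lambda>x. \<psi> x - \<phi> x) x) \<le> \<delta> * (1 - 0)"
    unfolding xray_fun_def
  proof (rule integral_bound[OF _ continuous_on_line[OF d]])
    fix t
    show "norm (\<psi> (x + t *\<^sub>R ivec v) - \<phi> (x + t *\<^sub>R ivec v)) \<le> \<delta>"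
      using norm_le_sup_norm[OF _ continuous_test_function[OF d], of "x + t *\<^sub>R ivec v"] d sup
      by (simp add: test_functions_def)
  qed simp
  moreover have "xray_fun v (\<lambda>x. \<psi> x - \<phi> x) x = xray_fun v \<psi> x - xray_fun v \<phi> x"
    unfolding xray_fun_def by (rule integral_diff[OF int[OF \<psi>] int[OF \<phi>]])
  ultimately show "norm (?u \<psi> - ?u \<phi>) \<le> 1 * \<delta>" by (simp add: \<phi> \<psi>)
qed

lemma xray_fun_fseries:
  assumes a: "rapid a"
  shows "xray_fun v (fseries a) = fseries (\<lambda>k. if perp v k then a k else 0)"
proof
  fix x
  have "((\<lambda>k. a k * ((if perp v k then 1 else 0) * character k x)) has_sum xray_fun v (fseries a) x) UNIV"
    using distribution_fseries[OF xray_fun_point_in_distributions[of v x] a]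
    by (simp add: character_in_test fseries_in_test[OF a] xray_fun_character)
  from infsumI[OF this, symmetric]
  show "xray_fun v (fseries a) x = fseries (\<lambda>k. if perp v k then a k else 0) x"
    unfolding fseries_def by (simp only:) (rule infsum_cong, simp)
qed

lemma xray_fseries:
  assumes h: "h \<in> distributions" and a: "rapid a"
  shows "((\<lambda>k. if perp v k then a k * h (character k) else 0) has_sum xray h v (fseries a)) UNIV"
  using distribution_fseries[OF h rapid_restrict[OF a, of "perp v"]]
  by (simp add: xray_def fseries_in_test[OF a] xray_fun_fseries[OF a] if_distrib[of "\<lambda>z. z * _"]
      cong: if_cong)

lemma fourier_xray:
  assumes h: "h \<in> distributions"
  shows "fourier (xray h v) k = (if perp v k then fourier h k else 0)"
proof -
  have "xray_fun v (character (- k)) = (\<lambda>x. (if perp v k then 1 else 0) * character (- k) x)"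
    by (auto simp: fun_eq_iff xray_fun_character)
  then have "fourier (xray h v) k = h (\<lambda>x. (if perp v k then 1 else 0) * character (- k) x)"
    by (simp add: fourier_def xray_def character_in_test)
  also have "\<dots> = (if perp v k then 1 else 0) * fourier h k"
    unfolding fourier_def by (rule distribution_scale[OF h character_in_test])
  finally show ?thesis by simp
qed

text \<open>A primitive vector is orthogonal to \<open>k = (a, b)\<close> if and only if the rotated vector \<open>(- b, a)\<close> is an
  integer multiple of it, and \<open>Q\<close> contains exactly one such primitive vector.\<close>

lemma direction_set_perp:
  assumes Q: "direction_set Q" and k: "k \<noteq> 0"
  shows "\<exists>!v. v \<in> Q \<and> perp v k"
proof -
  obtain a b where kab: "k = (a, b)" by (cases k)
  define w where "w = (- b, a)"
  have "w \<noteq> 0" using k by (auto simp: w_def kab zero_prod_def)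
  with Q have ex1: "\<exists>!q. q \<in> Q \<and> (\<exists>m::int. w = (m * fst q, m * snd q))"
    unfolding direction_set_def by blast
  have iff: "perp q k \<longleftrightarrow> (\<exists>m::int. w = (m * fst q, m * snd q))" if q: "q \<in> Q" for q
  proof
    obtain c d where cd: "q = (c, d)" by (cases q)
    from Q q have gcd: "coprime c d"
      by (auto simp: direction_set_def cd coprime_iff_gcd_eq_1)
    assume "perp q k"
    then have eq: "c * a = - (d * b)" by (simp add: cd kab)
    then have "c dvd d * b" by (metis dvd_minus_iff dvd_triv_left)
    then have "c dvd b" using gcd by (simp add: coprime_dvd_mult_right_iff)
    then obtain t where t: "b = c * t" ..
    show "\<exists>m. w = (m * fst q, m * snd q)"
    proof (cases "c = 0")
      case False
      from eq have "c * a = c * (- (d * t))" by (simp add: t)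
      then have "a = - (d * t)" using False by (metis mult_cancel_left)
      then show ?thesis by (intro exI[of _ "- t"]) (simp add: w_def cd t mult.commute)
    next
      case True
      with gcd have "\<bar>d\<bar> = 1" by simp
      then have "d * d = 1" by (metis abs_mult_self_eq mult_1)
      then show ?thesis using True t by (intro exI[of _ "a * d"]) (simp add: w_def cd mult.assoc)
    qed
  next
    assume "\<exists>m. w = (m * fst q, m * snd q)"
    then obtain m where m: "- b = m * fst q" "a = m * snd q" by (auto simp: w_def)
    have "fst q * a + snd q * b = fst q * (m * snd q) - snd q * (m * fst q)"
      using m by (metis add.inverse_inverse mult_minus_right diff_conv_add_uminus)
    then show "perp q k" by (simp add: kab)
  qed
  from ex1 show ?thesis using iff by metis
qed

section \<open>The Tikhonov functional on the Fourier side\<close>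

lemma ennreal_summable_on [simp]: "(g :: 'a \<Rightarrow> ennreal) summable_on A"
  by (rule nonneg_summable_on_complete) simp

lemma ennreal_infsum_cmult:
  fixes g :: "'a \<Rightarrow> ennreal"
  assumes "c < top"
  shows "c * (\<Sum>\<^sub>\<infinity>k\<in>A. g k) = (\<Sum>\<^sub>\<infinity>k\<in>A. c * g k)"
proof (rule infsumI[symmetric])
  have "(g has_sum infsum g A) A" by (intro has_sum_infsum ennreal_summable_on)
  then have "((\<lambda>F. c * sum g F) \<longlongrightarrow> c * infsum g A) (finite_subsets_at_top A)"
    unfolding has_sum_def by (intro ennreal_tendsto_cmult assms)
  then show "((\<lambda>k. c * g k) has_sum c * infsum g A) A"
    unfolding has_sum_def by (simp only: sum_distrib_left)
qed

text \<open>For each non-zero frequency the sum over the directions has a single non-zero term.\<close>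

lemma data_norm2_perp:
  assumes Q: "direction_set Q"
    and g: "\<And>v k. v \<in> Q \<Longrightarrow> fourier (g v) k = (if perp v k then c k else 0)"
  shows "data_norm2 Q t g = (\<Sum>\<^sub>\<infinity>k. ennreal (japanese k powr (2 * t) * (norm (c k))\<^sup>2))"
proof -
  let ?T = "\<lambda>k. ennreal (japanese k powr (2 * t) * (norm (c k))\<^sup>2)"
  have "\<exists>v. v \<in> Q"
    using direction_set_perp[OF Q, of "(1, 0)"] by (auto simp: zero_prod_def)
  then have mean: "mean Q g = c 0"
    unfolding mean_def by (intro the_equality) (auto simp: g)
  have inner: "(\<Sum>\<^sub>\<infinity>v\<in>Q. ennreal (japanese k powr (2 * t) * (norm (fourier (g v) k))\<^sup>2)) = ?T k"
    if k: "k \<noteq> 0" for k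
  proof -
    obtain v where v: "v \<in> Q" "perp v k" and uniq: "\<And>w. w \<in> Q \<Longrightarrow> perp w k \<Longrightarrow> w = v"
      using direction_set_perp[OF Q k] by blast
    have "(\<Sum>\<^sub>\<infinity>w\<in>Q. ennreal (japanese k powr (2 * t) * (norm (fourier (g w) k))\<^sup>2)) =
        (\<Sum>\<^sub>\<infinity>w\<in>{v}. ?T k)"
    proof (rule infsum_cong_neutral)
      fix w assume "w \<in> Q - {v}"
      then have "w \<in> Q" "\<not> perp w k" using uniq by blast+
      then show "ennreal (japanese k powr (2 * t) * (norm (fourier (g w) k))\<^sup>2) = 0" by (simp add: g)
    qed (use v in \<open>auto simp: g\<close>)
    then show ?thesis by simp
  qed
  have "data_norm2 Q t g = ?T 0 + (\<Sum>\<^sub>\<infinity>k\<in>UNIV - {0}. ?T k)"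
    unfolding data_norm2_def mean
    using infsum_cong[of "UNIV - {0}", OF inner] by simp
  also have "\<dots> = (\<Sum>\<^sub>\<infinity>k\<in>{0} \<union> (UNIV - {0}). ?T k)"
    by (subst infsum_Un_disjoint) auto
  finally show ?thesis by (simp add: Un_Diff_cancel)
qed

text \<open>With \<open>q = w + u\<close> and \<open>c = w / q\<close> the identity is polynomial in \<open>q\<close> and \<open>c\<close>, and it splits into real and
  imaginary parts.\<close>

lemma complete_square:
  fixes a z :: complex
  assumes "w > 0" "u > 0"
  shows "w * (norm (z - a))\<^sup>2 + u * (norm z)\<^sup>2 =
    w * u / (w + u) * (norm a)\<^sup>2 + (w + u) * (norm (z - of_real (w / (w + u)) * a))\<^sup>2"
proof -
  define q c where "q = w + u" and "c = w / q"
  have "q > 0" using assms by (simp add: q_def)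
  then have w: "w = c * q" and u: "u = (1 - c) * q"
    by (simp_all add: c_def q_def field_simps)
  have wu: "w * u / q = c * (1 - c) * q"
    unfolding w u using \<open>q > 0\<close> by simp
  have "w * (x - b)\<^sup>2 + u * x\<^sup>2 = w * u / q * b\<^sup>2 + q * (x - c * b)\<^sup>2" for x b
    unfolding wu unfolding w u by (simp add: power2_eq_square algebra_simps)
  from this[of "Re z" "Re a"] this[of "Im z" "Im a"] show ?thesis
    unfolding q_def[symmetric] c_def[symmetric] by (simp add: cmod_power2 algebra_simps)
qed

text \<open>The factor by which the optimal reconstruction damps the frequency \<open>k\<close>.\<close>

definition damping :: "real \<Rightarrow> real \<Rightarrow> freq \<Rightarrow> real" where
  "damping \<alpha> \<sigma> k = 1 / (1 + \<alpha> * japanese k powr (2 * \<sigma>))"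

lemma damping_bounds:
  assumes "\<alpha> > 0"
  shows "0 < damping \<alpha> \<sigma> k" "damping \<alpha> \<sigma> k \<le> 1"
proof -
  have "0 \<le> \<alpha> * japanese k powr (2 * \<sigma>)" using assms by simp
  then show "0 < damping \<alpha> \<sigma> k" "damping \<alpha> \<sigma> k \<le> 1"
    by (simp_all add: damping_def divide_simps)
qed

lemma damping_minus [simp]: "damping \<alpha> \<sigma> (- k) = damping \<alpha> \<sigma> k"
  by (simp add: damping_def)

lemma damping_weights:
  "japanese k powr (2 * r) / (japanese k powr (2 * r) + \<alpha> * japanese k powr (2 * s)) = damping \<alpha> (s - r) k"
proof -
  let ?w = "japanese k powr (2 * r)" and ?p = "japanese k powr (2 * (s - r))"
  have "japanese k powr (2 * s) = ?w * ?p"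
    by (simp flip: powr_add)
  then have "?w + \<alpha> * japanese k powr (2 * s) = ?w * (1 + \<alpha> * ?p)"
    by (simp add: algebra_simps)
  moreover have "?w \<noteq> 0" using japanese_pos[of k] by simp
  ultimately show ?thesis by (simp add: damping_def)
qed

lemma tikhonov_functional_eq:
  assumes Q: "direction_set Q" and \<alpha>: "\<alpha> > 0" and f: "f \<in> distributions" and h: "h \<in> distributions"
  shows "tikhonov_functional Q r s \<alpha> (xray f) h =
    (\<Sum>\<^sub>\<infinity>k. ennreal (\<alpha> * japanese k powr (2 * s) * damping \<alpha> (s - r) k * (norm (fourier f k))\<^sup>2)) +
    (\<Sum>\<^sub>\<infinity>k. ennreal ((japanese k powr (2 * r) + \<alpha> * japanese k powr (2 * s)) *
       (norm (fourier h k - of_real (damping \<alpha> (s - r) k) * fourier f k))\<^sup>2))"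
proof -
  let ?w = "\<lambda>k. japanese k powr (2 * r)" and ?u = "\<lambda>k. \<alpha> * japanese k powr (2 * s)"
  have pos: "?w k > 0" "?u k > 0" for k using japanese_pos[of k] \<alpha> by simp_all
  have "data_norm2 Q r (\<lambda>v. dist_diff (xray h v) (xray f v)) =
      (\<Sum>\<^sub>\<infinity>k. ennreal (?w k * (norm (fourier h k - fourier f k))\<^sup>2))"
  proof (rule data_norm2_perp[OF Q])
    fix v k
    have "fourier (dist_diff (xray h v) (xray f v)) k = fourier (xray h v) k - fourier (xray f v) k"
      by (simp add: fourier_def dist_diff_def character_in_test)
    then show "fourier (dist_diff (xray h v) (xray f v)) k =
        (if perp v k then fourier h k - fourier f k else 0)"
      by (simp add: fourier_xray f h)
  qed
  moreover have "ennreal \<alpha> * sobolev_norm2 s h = (\<Sum>\<^sub>\<infinity>k. ennreal (?u k * (norm (fourier h k))\<^sup>2))"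
    unfolding sobolev_norm2_def using \<alpha>
    by (subst ennreal_infsum_cmult) (simp_all add: mult.assoc flip: ennreal_mult)
  ultimately have "tikhonov_functional Q r s \<alpha> (xray f) h =
      (\<Sum>\<^sub>\<infinity>k. ennreal (?w k * (norm (fourier h k - fourier f k))\<^sup>2 + ?u k * (norm (fourier h k))\<^sup>2))"
    unfolding tikhonov_functional_def using pos
    by (simp add: infsum_add less_imp_le ennreal_plus)
  also have "\<dots> = (\<Sum>\<^sub>\<infinity>k. ennreal (?u k * damping \<alpha> (s - r) k * (norm (fourier f k))\<^sup>2) +
      ennreal ((?w k + ?u k) * (norm (fourier h k - of_real (damping \<alpha> (s - r) k) * fourier f k))\<^sup>2))"
  proof (rule infsum_cong)
    fix k
    have "?w k * ?u k / (?w k + ?u k) = ?u k * damping \<alpha> (s - r) k"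
      unfolding damping_weights[symmetric] by simp
    with complete_square[OF pos[of k], of "fourier h k" "fourier f k"]
    have "?w k * (norm (fourier h k - fourier f k))\<^sup>2 + ?u k * (norm (fourier h k))\<^sup>2 =
      ?u k * damping \<alpha> (s - r) k * (norm (fourier f k))\<^sup>2 +
      (?w k + ?u k) * (norm (fourier h k - of_real (damping \<alpha> (s - r) k) * fourier f k))\<^sup>2"
      unfolding damping_weights by simp
    then show "ennreal (?w k * (norm (fourier h k - fourier f k))\<^sup>2 + ?u k * (norm (fourier h k))\<^sup>2) =
      ennreal (?u k * damping \<alpha> (s - r) k * (norm (fourier f k))\<^sup>2) +
      ennreal ((?w k + ?u k) * (norm (fourier h k - of_real (damping \<alpha> (s - r) k) * fourier f k))\<^sup>2)"
      using pos[of k] damping_bounds[OF \<alpha>, of "s - r" k]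
      by (subst ennreal_plus[symmetric]) (auto intro!: mult_nonneg_nonneg)
  qed
  finally show ?thesis by (simp add: infsum_add)
qed

lemma data_norm2_xray:
  assumes "direction_set Q" "f \<in> distributions"
  shows "data_norm2 Q t (xray f) = sobolev_norm2 t f"
  unfolding sobolev_norm2_def by (rule data_norm2_perp[OF assms(1)]) (simp add: fourier_xray assms(2))

lemma ennreal_term_le_infsum: "g k \<le> (\<Sum>\<^sub>\<infinity>k. g k :: ennreal)"
  using infsum_mono_neutral[of g "{k}" g UNIV] by simp

text \<open>The terms of the convergent series for the Sobolev norm are bounded, whence
  \<open>|f(k)| \<le> C \<langle>k\<rangle>\<^sup>-\<^sup>r \<le> C \<langle>k\<rangle>\<^sup>M\<close> for any \<open>M \<ge> |r|\<close>.\<close>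

lemma sobolev_moderate:
  assumes f: "sobolev_norm2 r f < \<infinity>"
  shows "moderate (fourier f)"
proof -
  define K where "K = enn2real (sobolev_norm2 r f)"
  define M where "M = nat \<lceil>\<bar>r\<bar>\<rceil>"
  have K: "sobolev_norm2 r f = ennreal K" "K \<ge> 0"
    using f by (simp_all add: K_def ennreal_enn2real less_top)
  have "norm (fourier f k) \<le> sqrt K * japanese k ^ M" for k
  proof -
    have "ennreal (japanese k powr (2 * r) * (norm (fourier f k))\<^sup>2) \<le> ennreal K"
      using ennreal_term_le_infsum[of "\<lambda>k. ennreal (japanese k powr (2 * r) * (norm (fourier f k))\<^sup>2)" k]
      by (simp only: K(1)[symmetric] sobolev_norm2_def)
    then have le: "japanese k powr (2 * r) * (norm (fourier f k))\<^sup>2 \<le> K"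
      using K(2) by simp
    have pow: "japanese k powr (2 * real M) = (japanese k ^ M)\<^sup>2"
      using powr_realpow[OF japanese_pos, of k "2 * M"] by (simp add: mult.commute flip: power_mult)
    have "- r \<le> real M" unfolding M_def by linarith
    then have "1 \<le> japanese k powr (2 * r + 2 * real M)"
      using japanese_ge_1[of k] by (intro ge_one_powr_ge_zero) auto
    then have "1 * (norm (fourier f k))\<^sup>2 \<le> japanese k powr (2 * r + 2 * real M) * (norm (fourier f k))\<^sup>2"
      by (rule mult_right_mono) simp
    also have "\<dots> = (japanese k powr (2 * r) * (norm (fourier f k))\<^sup>2) * (japanese k ^ M)\<^sup>2"
      by (simp add: powr_add pow)
    also have "\<dots> \<le> K * (japanese k ^ M)\<^sup>2"
      using le by (rule mult_right_mono) simp
    also have "\<dots> = (sqrt K * japanese k ^ M)\<^sup>2"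
      using K(2) by (simp add: power_mult_distrib)
    finally have "(norm (fourier f k))\<^sup>2 \<le> (sqrt K * japanese k ^ M)\<^sup>2" by simp
    then show ?thesis
      by (rule power2_le_imp_le) (use K(2) japanese_pos[of k] in simp)
  qed
  then show ?thesis unfolding moderate_def by blast
qed

definition damped :: "real \<Rightarrow> real \<Rightarrow> functional \<Rightarrow> functional" where
  "damped \<alpha> \<sigma> f = dist_of_coeffs (\<lambda>k. of_real (damping \<alpha> \<sigma> k) * fourier f k)"

lemma damped_in_sobolev:
  assumes \<alpha>: "\<alpha> > 0" and f: "sobolev_norm2 r f < \<infinity>"
  shows "damped \<alpha> \<sigma> f \<in> sobolev r"
    and "fourier (damped \<alpha> \<sigma> f) k = of_real (damping \<alpha> \<sigma> k) * fourier f k"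
proof -
  let ?c = "\<lambda>k. of_real (damping \<alpha> \<sigma> k) * fourier f k"
  have le: "norm (?c k) \<le> norm (fourier f k)" for k
    using damping_bounds[OF \<alpha>, of \<sigma> k] by (simp add: norm_mult mult_left_le_one_le)
  then have "moderate ?c"
    using sobolev_moderate[OF f] unfolding moderate_def by (meson order_trans)
  then have "damped \<alpha> \<sigma> f \<in> distributions"
    unfolding damped_def by (rule dist_of_coeffs_in_distributions)
  moreover have four: "fourier (damped \<alpha> \<sigma> f) k = ?c k" for k
    unfolding damped_def by (rule fourier_dist_of_coeffs)
  moreover have "sobolev_norm2 r (damped \<alpha> \<sigma> f) \<le> sobolev_norm2 r f"
    unfolding sobolev_norm2_def four
    using le by (intro infsum_mono ennreal_summable_on ennreal_leI mult_left_mono power_mono) auto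
  ultimately show "damped \<alpha> \<sigma> f \<in> sobolev r" "fourier (damped \<alpha> \<sigma> f) k = ?c k"
    using f by (auto simp: sobolev_def)
qed

text \<open>The functional is \<open>A + E\<close> with \<open>A\<close> independent of \<open>h\<close>, and \<open>E\<close> vanishes only at \<open>damped\<close>.  Finiteness of \<open>A\<close>,
  which lies below the squared \<open>H\<^sup>r\<close> norm of \<open>f\<close>, is needed for uniqueness: only then does \<open>E > 0\<close> make the
  value strictly larger.\<close>

lemma tikhonov_minimizer_iff:
  assumes Q: "direction_set Q" and \<alpha>: "\<alpha> > 0" and f: "f \<in> distributions"
    and fr: "sobolev_norm2 r f < \<infinity>"
  shows "tikhonov_minimizer Q r s \<alpha> (xray f) h \<longleftrightarrow> h = damped \<alpha> (s - r) f"
proof -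
  let ?T = "tikhonov_functional Q r s \<alpha> (xray f)" and ?h = "damped \<alpha> (s - r) f"
  let ?d = "damping \<alpha> (s - r)"
  define A where "A = (\<Sum>\<^sub>\<infinity>k. ennreal (\<alpha> * japanese k powr (2 * s) * ?d k * (norm (fourier f k))\<^sup>2))"
  define E where "E = (\<lambda>h. \<Sum>\<^sub>\<infinity>k. ennreal ((japanese k powr (2 * r) + \<alpha> * japanese k powr (2 * s)) *
       (norm (fourier h k - of_real (?d k) * fourier f k))\<^sup>2))"
  have T: "?T h = A + E h" if "h \<in> sobolev r" for h
    using tikhonov_functional_eq[OF Q \<alpha> f, of h r s] that by (simp add: A_def E_def sobolev_def)
  note damped = damped_in_sobolev[OF \<alpha> fr, of "s - r"]
  have "A \<le> sobolev_norm2 r f"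
    unfolding A_def sobolev_norm2_def
  proof (intro infsum_mono ennreal_summable_on ennreal_leI mult_right_mono)
    fix k
    let ?w = "japanese k powr (2 * r)" and ?u = "\<alpha> * japanese k powr (2 * s)"
    have pos: "?w > 0" "?u > 0" using japanese_pos[of k] \<alpha> by simp_all
    have "?u * ?d k = ?w * (?u / (?w + ?u))" unfolding damping_weights[symmetric] by simp
    also have "\<dots> \<le> ?w * 1" using pos
      by (intro mult_left_mono divide_le_eq_1_pos[THEN iffD2] add_pos_pos) auto
    finally show "?u * ?d k \<le> ?w" by simp
  qed auto
  then have A: "A < top" using fr by simp
  have E0: "E ?h = 0" by (simp add: E_def damped(2))
  show ?thesis
  proof
    assume "h = ?h"
    then show "tikhonov_minimizer Q r s \<alpha> (xray f) h"
      using damped(1) T E0 by (auto simp: tikhonov_minimizer_def is_arg_min_def not_less)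
  next
    assume "tikhonov_minimizer Q r s \<alpha> (xray f) h"
    then have h: "h \<in> sobolev r" and "\<not> ?T ?h < ?T h"
      using damped(1) by (auto simp: tikhonov_minimizer_def is_arg_min_def)
    then have "A + E h \<le> A + 0" using T[OF h] T[OF damped(1)] E0 by simp
    then have "E h = 0" using A by (auto simp: ennreal_add_left_cancel_le)
    have "fourier h k = fourier ?h k" for k
    proof -
      have "ennreal ((japanese k powr (2 * r) + \<alpha> * japanese k powr (2 * s)) *
          (norm (fourier h k - of_real (?d k) * fourier f k))\<^sup>2) \<le> 0"
        using ennreal_term_le_infsum[of "\<lambda>k. ennreal ((japanese k powr (2 * r) + \<alpha> * japanese k powr (2 * s)) *
          (norm (fourier h k - of_real (?d k) * fourier f k))\<^sup>2)" k] \<open>E h = 0\<close> by (simp add: E_def)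
      moreover have "japanese k powr (2 * r) + \<alpha> * japanese k powr (2 * s) > 0"
        using japanese_pos[of k] \<alpha> by (intro add_pos_pos) simp_all
      ultimately have "(norm (fourier h k - of_real (?d k) * fourier f k))\<^sup>2 \<le> 0"
        by (auto simp: ennreal_eq_0_iff mult_le_0_iff)
      then show ?thesis by (simp add: damped(2))
    qed
    then show "h = ?h"
      using h damped(1) by (intro distribution_eqI) (auto simp: sobolev_def)
  qed
qed

section \<open>Convergence of the filtered partial reconstructions\<close>

text \<open>Translating a test function multiplies its coefficients by the values of the characters, so the
  inner pairing in the convolution is again a Fourier series in the translation.\<close>

lemma tikhonov_filter_shift:
  assumes \<alpha>: "\<alpha> > 0" and \<phi>: "\<phi> \<in> test_functions"
  shows "tikhonov_filter \<alpha> \<sigma> (\<lambda>y. \<phi> (x + y)) = fseries (\<lambda>k. of_real (damping \<alpha> \<sigma> k) * fcoeff \<phi> k) x"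
proof -
  let ?a = "\<lambda>k. character k x * fcoeff \<phi> k"
  have "moderate (\<lambda>k. character k x)" by (rule moderate_bounded[of _ 1]) simp
  then have a: "rapid ?a" by (rule rapid_mult_moderate) (rule rapid_fcoeff[OF \<phi>])
  have "\<phi> (x + y) = fseries ?a y" for y
    by (subst test_function_eq_fseries[OF \<phi>]) (simp add: fseries_def character_add mult_ac)
  then have shift: "(\<lambda>y. \<phi> (x + y)) = fseries ?a" by (rule ext)
  have "tikhonov_filter \<alpha> \<sigma> (fseries ?a) =
      (\<Sum>\<^sub>\<infinity>k. of_real (damping \<alpha> \<sigma> k) * ?a (- k))"
    by (simp add: tikhonov_filter_def damping_def fseries_in_test[OF a] dist_of_character
        fcoeff_fseries[OF a])
  also have "\<dots> = (\<Sum>\<^sub>\<infinity>k. of_real (damping \<alpha> \<sigma> k) * ?a k)"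
    using infsum_reindex_bij_betw[OF bij_uminus, of "\<lambda>k. of_real (damping \<alpha> \<sigma> k) * ?a k"] by simp
  also have "\<dots> = fseries (\<lambda>k. of_real (damping \<alpha> \<sigma> k) * fcoeff \<phi> k) x"
    by (simp add: fseries_def mult_ac)
  finally show ?thesis by (simp only: shift)
qed

lemma has_sum_sum:
  fixes g :: "'a \<Rightarrow> 'b \<Rightarrow> 'c :: topological_comm_monoid_add"
  assumes "finite S" "\<And>v. v \<in> S \<Longrightarrow> (g v has_sum l v) A"
  shows "((\<lambda>k. \<Sum>v\<in>S. g v k) has_sum (\<Sum>v\<in>S. l v)) A"
  using assms by (induction S) (auto intro!: has_sum_add)

lemma directions_upto_finite:
  assumes "direction_set Q"
  shows "finite (directions_upto Q N)"
proof (rule finite_subset)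
  show "directions_upto Q N \<subseteq> (\<lambda>k. THE v. v \<in> Q \<and> perp v k) ` (box_freqs N - {0})"
  proof
    fix v assume "v \<in> directions_upto Q N"
    then obtain k where k: "k \<in> box_freqs N - {0}" and v: "v \<in> Q \<and> perp v k"
      unfolding directions_upto_def by blast
    have "(THE v. v \<in> Q \<and> perp v k) = v"
      using direction_set_perp[OF assms, of k] k v by (intro the1_equality) auto
    with k show "v \<in> (\<lambda>k. THE v. v \<in> Q \<and> perp v k) ` (box_freqs N - {0})" by blast
  qed
qed (simp add: box_freqs_def)

text \<open>The frequencies that some direction in \<open>Q\<^sub>N\<close> detects: there the partial reconstruction has the
  coefficient of \<open>f\<close>.\<close>

definition recovered :: "freq set \<Rightarrow> nat \<Rightarrow> freq set" where
  "recovered Q N = insert 0 {k. \<exists>v \<in> directions_upto Q N. perp v k}"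

lemma box_freqs_subset_recovered:
  assumes "direction_set Q"
  shows "box_freqs N \<subseteq> recovered Q N"
proof
  fix k assume k: "k \<in> box_freqs N"
  show "k \<in> recovered Q N"
  proof (cases "k = 0")
    case False
    then obtain v where "v \<in> Q" "perp v k" using direction_set_perp[OF assms False] by blast
    with k False have "v \<in> directions_upto Q N" by (auto simp: directions_upto_def)
    with \<open>perp v k\<close> show ?thesis by (auto simp: recovered_def)
  qed (simp add: recovered_def)
qed

text \<open>Each non-zero frequency is seen by a single direction, the zero frequency by all of them.  The
  subtracted constant removes the surplus copies of the latter.\<close>

lemma partial_reconstruction_fseries:
  assumes Q: "direction_set Q" and f: "f \<in> distributions" and b: "rapid b" and N: "N \<ge> 1"
  shows "((\<lambda>k. if k \<in> recovered Q N then b k * f (character k) else 0) has_sum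
      partial_reconstruction Q f N (fseries b)) UNIV"
proof -
  let ?D = "directions_upto Q N" and ?z = "\<lambda>k. b k * f (character k)"
  define n where "n = card ?D"
  have fin: "finite ?D" by (rule directions_upto_finite[OF Q])
  have n: "n > 0"
  proof -
    have "(1, 0) \<in> box_freqs N" "(1, 0) \<noteq> (0 :: freq)" using N by (auto simp: box_freqs_def zero_prod_def)
    then have "?D \<noteq> {}"
      using direction_set_perp[OF Q, of "(1, 0)"] unfolding directions_upto_def by blast
    then show ?thesis using fin by (simp add: n_def card_gt_0_iff)
  qed
  have const: "dist_of_fun (\<lambda>_. c) (fseries b) = c * b 0" for c
    using fcoeff_fseries[OF b, of 0] by (simp add: dist_of_fun_def fseries_in_test[OF b] fcoeff_def)
  have "partial_reconstruction Q f N (fseries b) =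
      (\<Sum>v\<in>?D. xray f v (fseries b)) - n * (of_real ((real n - 1) / real n) * fourier f 0 * b 0)"
    by (simp add: partial_reconstruction_def fseries_in_test[OF b] const sum_subtractf n_def)
  also have "n * (of_real ((real n - 1) / real n) * fourier f 0 * b 0) = (of_nat n - 1) * ?z 0"
    using n by (simp add: character_apply_fourier)
  finally have pr: "partial_reconstruction Q f N (fseries b) =
      (\<Sum>v\<in>?D. xray f v (fseries b)) + - ((of_nat n - 1) * ?z 0)" by simp
  have "((\<lambda>k. \<Sum>v\<in>?D. if perp v k then ?z k else 0) has_sum (\<Sum>v\<in>?D. xray f v (fseries b))) UNIV"
    by (rule has_sum_sum[OF fin xray_fseries[OF f b]])
  moreover have "((\<lambda>k. if k \<in> {0} then (of_nat n - 1) * ?z k else 0) has_sum (of_nat n - 1) * ?z 0) UNIV"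
    using has_sum_restrict_finite[of "{0}" "\<lambda>k. (of_nat n - 1) * ?z k"] by simp
  ultimately have "((\<lambda>k. (\<Sum>v\<in>?D. if perp v k then ?z k else 0) + - (if k \<in> {0} then (of_nat n - 1) * ?z k else 0))
      has_sum partial_reconstruction Q f N (fseries b)) UNIV"
    unfolding pr by (intro has_sum_add has_sum_uminusI)
  moreover have "(\<Sum>v\<in>?D. if perp v k then ?z k else 0) + - (if k \<in> {0} then (of_nat n - 1) * ?z k else 0) =
      (if k \<in> recovered Q N then ?z k else 0)" for k
  proof (cases "k = 0")
    case True
    then show ?thesis by (simp add: recovered_def n_def left_diff_distrib)
  next
    case False
    show ?thesis
    proof (cases "\<exists>v \<in> ?D. perp v k")
      case True
      then obtain v where v: "v \<in> ?D" "perp v k" by blast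
      have "w = v" if "w \<in> ?D" "perp w k" for w
        using direction_set_perp[OF Q False] v that by (auto simp: directions_upto_def)
      then have "(\<Sum>w\<in>?D. if perp w k then ?z k else 0) = (\<Sum>w\<in>?D. if w = v then ?z k else 0)"
        using v(2) by (intro sum.cong if_cong) blast+
      also have "\<dots> = ?z k" using fin v(1) by simp
      finally have "(\<Sum>w\<in>?D. if perp w k then ?z k else 0) = ?z k" .
      moreover have "k \<in> recovered Q N" using v unfolding recovered_def by blast
      ultimately show ?thesis using False by simp
    next
      case none: False
      then have "(\<Sum>w\<in>?D. if perp w k then ?z k else 0) = 0" by (intro sum.neutral) auto
      moreover have "k \<notin> recovered Q N" using none False unfolding recovered_def by blast
      ultimately show ?thesis using False by simp
    qed
  qed
  ultimately show ?thesis by simp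
qed

lemma filterlim_box_freqs: "filterlim box_freqs (finite_subsets_at_top UNIV) sequentially"
  unfolding filterlim_finite_subsets_at_top
proof (intro allI impI)
  fix X :: "freq set" assume X: "finite X \<and> X \<subseteq> UNIV"
  define m where "m = (\<Sum>k\<in>X. nat \<bar>fst k\<bar> + nat \<bar>snd k\<bar>)"
  have "X \<subseteq> box_freqs N" if "N \<ge> m" for N
  proof
    fix k assume "k \<in> X"
    then have "nat \<bar>fst k\<bar> + nat \<bar>snd k\<bar> \<le> m"
      unfolding m_def using X by (intro member_le_sum) auto
    with that show "k \<in> box_freqs N" by (auto simp: box_freqs_def mem_Times_iff)
  qed
  then show "\<forall>\<^sub>F N in sequentially. finite (box_freqs N) \<and> X \<subseteq> box_freqs N \<and> box_freqs N \<subseteq> UNIV"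
    by (intro eventually_sequentiallyI[of m]) (auto simp: box_freqs_def)
qed

text \<open>The set \<open>recovered Q N\<close> is infinite, but its complement lies outside of the finite box \<open>[-N, N]\<^sup>2\<close>, so the
  error is at most the tail of an absolutely convergent series beyond the box.\<close>

lemma filtered_reconstruction_tendsto:
  assumes Q: "direction_set Q" and \<alpha>: "\<alpha> > 0" and f: "f \<in> distributions"
    and fr: "sobolev_norm2 r f < \<infinity>" and \<phi>: "\<phi> \<in> test_functions"
  shows "(\<lambda>N. dist_conv (partial_reconstruction Q f N) (tikhonov_filter \<alpha> \<sigma>) \<phi>)
    \<longlonglongrightarrow> damped \<alpha> \<sigma> f \<phi>"
proof -
  let ?d = "\<lambda>k. complex_of_real (damping \<alpha> \<sigma> k)"
  define b where "b = (\<lambda>k. ?d k * fcoeff \<phi> k)"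
  have b: "rapid b"
    unfolding b_def
    by (rule rapid_dominated[OF rapid_fcoeff[OF \<phi>]])
      (use damping_bounds[OF \<alpha>, of \<sigma>] in \<open>simp add: norm_mult mult_left_le_one_le less_imp_le\<close>)
  have conv: "dist_conv (partial_reconstruction Q f N) (tikhonov_filter \<alpha> \<sigma>) \<phi> =
      partial_reconstruction Q f N (fseries b)" for N
    by (simp add: dist_conv_def \<phi> tikhonov_filter_shift[OF \<alpha> \<phi>] b_def)
  define z where "z = (\<lambda>k. b k * f (character k))"
  have "rapid (\<lambda>k. fourier f (- k) * b k)"
    by (rule rapid_mult_moderate[OF moderate_minus[OF sobolev_moderate[OF fr]] b])
  then have "rapid z" by (simp add: z_def character_apply_fourier mult.commute)
  then have znorm: "(\<lambda>k. norm (z k)) summable_on UNIV" by (rule rapid_abs_summable)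
  have zsum: "(z has_sum damped \<alpha> \<sigma> f \<phi>) UNIV"
    using distribution_apply[OF _ \<phi>, of "damped \<alpha> \<sigma> f"] damped_in_sobolev[OF \<alpha> fr]
    by (simp add: sobolev_def character_apply_fourier z_def b_def mult_ac)
  let ?tail = "\<lambda>N. (\<Sum>\<^sub>\<infinity>k. norm (z k)) - (\<Sum>k\<in>box_freqs N. norm (z k))"
  have "norm (partial_reconstruction Q f N (fseries b) - damped \<alpha> \<sigma> f \<phi>) \<le> ?tail N" if "N \<ge> 1" for N
  proof (rule norm_infsum_le)
    show "((\<lambda>k. (if k \<in> recovered Q N then z k else 0) + - z k) has_sum
        (partial_reconstruction Q f N (fseries b) - damped \<alpha> \<sigma> f \<phi>)) UNIV"
      using has_sum_add[OF partial_reconstruction_fseries[OF Q f b that] has_sum_uminusI[OF zsum[unfolded z_def]]]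
      by (simp add: z_def cong: if_cong)
    show "((\<lambda>k. norm (z k) + - (if k \<in> box_freqs N then norm (z k) else 0)) has_sum ?tail N) UNIV"
      using has_sum_add[OF has_sum_infsum[OF znorm]
          has_sum_uminusI[OF has_sum_restrict_finite[of "box_freqs N" "\<lambda>k. norm (z k)"]]]
      by (simp add: box_freqs_def)
    fix k
    show "norm ((if k \<in> recovered Q N then z k else 0) + - z k)
        \<le> norm (z k) + - (if k \<in> box_freqs N then norm (z k) else 0)"
      using box_freqs_subset_recovered[OF Q, of N] by auto
  qed
  then have bound: "\<forall>\<^sub>F N in sequentially.
      norm (partial_reconstruction Q f N (fseries b) - damped \<alpha> \<sigma> f \<phi>) \<le> ?tail N"
    by (rule eventually_sequentiallyI)
  have "((\<lambda>N. \<Sum>k\<in>box_freqs N. norm (z k)) \<longlongrightarrow> (\<Sum>\<^sub>\<infinity>k. norm (z k))) sequentially"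
    using filterlim_compose[OF _ filterlim_box_freqs] has_sum_infsum[OF znorm]
    unfolding has_sum_def by blast
  then have "?tail \<longlonglongrightarrow> (\<Sum>\<^sub>\<infinity>k. norm (z k)) - (\<Sum>\<^sub>\<infinity>k. norm (z k))"
    by (intro tendsto_diff tendsto_const)
  then have "?tail \<longlonglongrightarrow> 0" by simp
  from Lim_null_comparison[OF bound this]
  show ?thesis unfolding conv by (simp only: LIM_zero_iff)
qed

theorem theorem2p5:
  fixes Q :: "freq set" and r s \<alpha> :: real and f :: functional
  assumes "direction_set Q"
    and "s \<ge> r" and "\<alpha> > 0"
    and "f \<in> distributions"
    and "xray f \<in> data_space Q r"
  shows "(\<exists>!h. tikhonov_minimizer Q r s \<alpha> (xray f) h) \<and>
    dist_lim (\<lambda>N. dist_conv (partial_reconstruction Q f N) (tikhonov_filter \<alpha> (s - r)))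
      (tikhonov_solution Q r s \<alpha> (xray f))"
proof -
  have fr: "sobolev_norm2 r f < \<infinity>"
    using assms(5) data_norm2_xray[OF assms(1,4), of r] by (simp add: data_space_def)
  note min = tikhonov_minimizer_iff[OF assms(1,3,4) fr]
  have "tikhonov_solution Q r s \<alpha> (xray f) = damped \<alpha> (s - r) f"
    unfolding tikhonov_solution_def min by (rule the_eq_trivial)
  then show ?thesis
    unfolding dist_lim_def min
    using filtered_reconstruction_tendsto[OF assms(1,3,4) fr] by simp
qed

end
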